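(* Let $\mathbb{N}=\{0,1,2,\ldots\}$ and $t_x=x(x+1)/2$ for $x\in\mathbb{Z}$. (i) Any $n\in\mathbb{N}$ is a sum of an even square and two triangular numbers; that is, $n=x^2+t_y+t_z$ for some $x,y,z\in\mathbb{Z}$ with $x$ even. Moreover, if $n\in\mathbb{N}$ and $n/2$ is not a triangular number, then $$|\{(x,y,z)\in\mathbb{Z}\times\mathbb{N}\times\mathbb{N}:\ x^2+t_y+t_z=n\ \text{and}\ 2\nmid x\}|=|\{(x,y,z)\in\mathbb{Z}\times\mathbb{N}\times\mathbb{N}:\ x^2+t_y+t_z=n\ \text{and}\ 2\mid x\}|.$$ (ii) If $n\in\mathbb{N}$ is not a triangular number, then $$|\{(x,y,z)\in\mathbb{Z}\times\mathbb{Z}\times\mathbb{N}:\ x^2+y^2+t_z=n\ \text{and}\ x\not\equiv y \pmod 2\}|=|\{(x,y,z)\in\mathbb{Z}\times\mathbb{Z}\times\mathbb{N}:\ x^2+y^2+t_z=n\ \text{and}\ x\equiv y\pmod 2\}|>0.$$ (iii) Every positive integer $n$ is a sum of an odd square, an even square and a triangular number (that is, $n=x^2+y^2+t_z$ for some $x,y,z\in\mathbb{Z}$ with $x$ odd and $y$ even), unless $n=t_m$ for some integer $m>0$ such that all prime divisors of $2m+1$ are congruent to $1$ modulo $4$. Moreover, whenever $m>0$ is an integer such that all prime divisors of $2m+1$ are congruent to $1$ modulo $4$, one has $t_m=x^2+x^2+t_z$ for some integers $x>0$ and $z$ with $x\equiv m/2\pmod 2$.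
   Context: The triangular numbers are the integers $t_x=x(x+1)/2$ with $x\in\mathbb{Z}$ (so $0=t_0$ is triangular, and $t_{-x-1}=t_x$). An integer square is $x^2$ with $x\in\mathbb{Z}$; it is called even (odd) if it is an even (odd) integer, and $0$ is an even square. If $n$ is odd, then $n/2$ is not an integer and hence not a triangular number. The number $m/2$ in (iii) is an integer, because the condition on the prime divisors of $2m+1$ forces $2m+1\equiv 1\pmod 4$. $|S|$ denotes the cardinality of the finite set $S$. *)

theory Defs
  imports "HOL-Number_Theory.Number_Theory"
begin

text \<open>The division is exact, since \<open>x * (x + 1)\<close> is always even.\<close>

definition tri :: "int \<Rightarrow> int" where
  "tri x = x * (x + 1) div 2"

text \<open>Defined on the rationals, so that one can ask whether \<open>n / 2\<close> is triangular
  for any natural number \<open>n\<close>; for odd \<open>n\<close> the answer is no.\<close>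

definition triangular :: "rat \<Rightarrow> bool" where
  "triangular q \<longleftrightarrow> (\<exists>x. q = of_int (tri x))"

definition all_prime_divisors_1_mod_4 :: "int \<Rightarrow> bool" where
  "all_prime_divisors_1_mod_4 k \<longleftrightarrow> (\<forall>p. prime p \<longrightarrow> p dvd k \<longrightarrow> [p = 1] (mod 4))"

end

theory Submission
  imports Defs "HOL-Analysis.Analysis"
begin

text \<open>
  Let \<open>phi\<close>, \<open>psi\<close> be Ramanujan's theta series, the sums of \<open>q ^ x\<^sup>2\<close> over the integers and of
  \<open>q ^ tri y\<close> over the naturals. Both counting identities are coefficient comparisons in
  \<open>phi(-q)\<^sup>2 psi(q) = (\<Sum>m. (-1)^m (2m+1) q ^ tri m)\<close>. Instead of infinite products, one rotates
  the lattice of pairs of integers by 45 degrees: this shows that the quotient of the two sides is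
  invariant under \<open>q \<mapsto> q\<^sup>2\<close>, so it equals its limit \<open>1\<close> at \<open>q = 0\<close>.

  Positivity of the counts amounts to the three-square theorem for numbers \<open>4n+1\<close>. It follows from
  the class number formula
  \<open>phi(q)\<^sup>2 psi(q\<^sup>2) = (\<Sum>a\<ge>0. \<Sum>\<bar>b\<bar>\<le>a. \<Sum>c. q ^ (a\<^sup>2 + a - b\<^sup>2 + (2a+1)\<bar>c\<bar>))\<close>, where the terms
  with \<open>a = b = 0\<close> already produce every exponent. To prove it, multiply the right-hand side by
  \<open>phi(-q)\<close>, complete squares and sum over \<open>b\<close>; a partial fraction decomposition then splits the double
  series into a product of the Lambert series \<open>phi(q)\<^sup>2\<close> and an Appell-Lerch sum, which is evaluated
  by telescoping.

  For the last part, if \<open>p\<close> is \<open>3\<close> modulo \<open>4\<close> and \<open>m = (p-1)/2\<close>, the coefficient of \<open>q ^ tri m\<close> in the cube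
  series is \<open>-p < 0\<close>, which forces a representation of \<open>tri m\<close> with \<open>x + y\<close> odd; it is scaled
  to all odd multiples of \<open>p\<close>. If all prime divisors of \<open>2m+1\<close> are \<open>1\<close> modulo \<open>4\<close>, Jacobi's count of
  representations gives \<open>2m+1 = a\<^sup>2 + b\<^sup>2\<close> with \<open>a, b\<close> nonzero, and then
  \<open>(2m+1)\<^sup>2 = (a\<^sup>2 - b\<^sup>2)\<^sup>2 + (2ab)\<^sup>2\<close>.
\<close>

section \<open>Sums over the integers\<close>

definition alt :: "int \<Rightarrow> real" where
  "alt n = (if even n then 1 else -1)"

lemma alt_add: "alt (m + n) = alt m * alt n"
  and alt_diff: "alt (m - n) = alt m * alt n"
  and alt_minus: "alt (- n) = alt n"
  and alt_mult_self: "alt n * alt n = 1"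
  and abs_alt: "\<bar>alt n\<bar> = 1"
  and alt_double: "alt (2 * n) = 1"
  by (auto simp: alt_def)

lemma tri_double: "2 * tri x = x * (x + 1)"
  unfolding tri_def by simp

lemma tri_reflect: "tri (- 1 - x) = tri x"
  using tri_double[of x] tri_double[of "- 1 - x"] by (simp add: algebra_simps)

lemma tri_add_diff: "tri (u + v) + tri (u - v) = v\<^sup>2 + 2 * tri u"
  using tri_double[of "u + v"] tri_double[of "u - v"] tri_double[of u]
  by (simp add: algebra_simps power2_eq_square)

text \<open>A linear lower bound on the exponent is enough to dominate \<open>q powi tri n\<close>
  by a multiple of the two-sided geometric series.\<close>

lemma tri_ge: "\<bar>x\<bar> - 1 \<le> tri x"
proof -
  have "0 \<le> (x - 1) * x" if "x \<ge> 0" using that by (cases "x = 0") auto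
  moreover have "0 \<le> (x + 1) * (x + 2)" if "x < 0"
    using that by (cases "x = -1") (auto intro: mult_nonpos_nonpos)
  ultimately show ?thesis
    using tri_double[of x] by (cases "x \<ge> 0") (auto simp: algebra_simps)
qed

lemma tri_nonneg: "0 \<le> tri x"
  using tri_ge[of x] by (cases "x = 0") (auto simp: tri_def)

lemma abs_le_power2: "\<bar>x::int\<bar> \<le> x\<^sup>2"
proof -
  have "\<bar>x\<bar> * 1 \<le> \<bar>x\<bar> * \<bar>x\<bar>" by (cases "x = 0") (simp, intro mult_left_mono, auto)
  then show ?thesis by (simp add: power2_eq_square flip: abs_mult)
qed

section \<open>Summability, products and reindexing of real families\<close>

lemma summable_geometric_int:
  fixes r :: real
  assumes "0 < r" "r < 1"
  shows "(\<lambda>n::int. r powi \<bar>n\<bar>) summable_on UNIV"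
proof -
  have nat: "(\<lambda>n::nat. r ^ n) summable_on UNIV"
    using assms by (intro norm_summable_imp_summable_on) (auto intro!: summable_geometric)
  have "(\<lambda>n::int. r powi \<bar>n\<bar>) summable_on {0..}"
    using nat
    by (subst summable_on_reindex_bij_witness[of _ int nat UNIV "\<lambda>n. r ^ n"])
       (auto simp: power_int_nonneg_exp)
  moreover have "(\<lambda>n::int. r powi \<bar>n\<bar>) summable_on {..0}"
    using nat
    by (subst summable_on_reindex_bij_witness[of _ "\<lambda>n. - int n" "\<lambda>n. nat (- n)" UNIV "\<lambda>n. r ^ n"])
       (auto simp: power_int_nonneg_exp)
  ultimately have "(\<lambda>n::int. r powi \<bar>n\<bar>) summable_on {0..} \<union> {..0}"
    by (rule summable_on_union)
  also have "{0..} \<union> {..0} = (UNIV :: int set)" by auto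
  finally show ?thesis .
qed

lemma summable_on_bound:
  fixes f g :: "'a \<Rightarrow> real"
  assumes "g summable_on A" "\<And>x. x \<in> A \<Longrightarrow> \<bar>f x\<bar> \<le> g x"
  shows "f summable_on A"
proof -
  have "(\<lambda>x. norm (f x)) summable_on A"
    by (rule Infinite_Sum.abs_summable_on_comparison_test'[OF assms(1)]) (use assms(2) in simp)
  then show ?thesis using summable_on_iff_abs_summable_on_real by blast
qed

lemma summable_on_mult_bound:
  fixes f g :: "'a \<Rightarrow> real"
  assumes "g summable_on A" "\<And>x. x \<in> A \<Longrightarrow> \<bar>f x\<bar> \<le> K * g x"
  shows "f summable_on A"
  by (rule summable_on_bound[OF summable_on_cmult_right[OF assms(1)] assms(2)])

text \<open>Summability of a real family is absolute, so the absolute values of the products can be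
  summed row by row. This gives summability over the product set, and summing by rows then gives the
  value.\<close>

lemma has_sum_product:
  fixes f :: "'a \<Rightarrow> real" and g :: "'b \<Rightarrow> real"
  assumes f: "f summable_on A" and g: "g summable_on B"
  shows "((\<lambda>(x, y). f x * g y) has_sum (infsum f A * infsum g B)) (A \<times> B)"
proof -
  have absf: "(\<lambda>x. \<bar>f x\<bar>) summable_on A" and absg: "(\<lambda>x. \<bar>g x\<bar>) summable_on B"
    using f g summable_on_iff_abs_summable_on_real by auto
  have "(\<lambda>(x, y). \<bar>f x\<bar> * \<bar>g y\<bar>) summable_on A \<times> B"
  proof (rule summable_on_SigmaI)
    show "((\<lambda>y. case (x, y) of (x, y) \<Rightarrow> \<bar>f x\<bar> * \<bar>g y\<bar>) has_sum (\<bar>f x\<bar> * (\<Sum>\<^sub>\<infinity>y\<in>B. \<bar>g y\<bar>))) B" for x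
      unfolding prod.case by (intro has_sum_cmult_right has_sum_infsum absg)
    show "(\<lambda>x. \<bar>f x\<bar> * (\<Sum>\<^sub>\<infinity>y\<in>B. \<bar>g y\<bar>)) summable_on A"
      by (intro summable_on_cmult_left absf)
  qed simp
  then have summable: "(\<lambda>(x, y). f x * g y) summable_on A \<times> B"
    by (rule summable_on_bound) (auto simp: abs_mult)
  show ?thesis
  proof (rule has_sum_SigmaI[OF _ _ summable])
    show "((\<lambda>y. case (x, y) of (x, y) \<Rightarrow> f x * g y) has_sum (f x * infsum g B)) B" for x
      unfolding prod.case by (intro has_sum_cmult_right has_sum_infsum g)
    show "((\<lambda>x. f x * infsum g B) has_sum (infsum f A * infsum g B)) A"
      by (intro has_sum_cmult_left has_sum_infsum f)
  qed
qed

lemma summable_on_product_bound: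
  fixes h :: "'a \<times> 'b \<Rightarrow> real"
  assumes "f summable_on A" "g summable_on B"
    and "\<And>x y. x \<in> A \<Longrightarrow> y \<in> B \<Longrightarrow> \<bar>h (x, y)\<bar> \<le> K * (f x * g y)"
  shows "h summable_on A \<times> B"
  by (rule summable_on_mult_bound[OF has_sum_imp_summable[OF has_sum_product[OF assms(1,2)]]])
     (use assms(3) in auto)

text \<open>Reindexing by n -> c - n turns the sum into its own negative; for a family that is not
  summable, \<open>infsum\<close> is 0 by convention. The typical use has c odd, so that
  \<open>alt\<close> changes sign while a quadratic exponent centred at c/2 does not change.\<close>

lemma infsum_antisym:
  fixes f :: "int \<Rightarrow> real"
  assumes "\<And>n. f (c - n) = - f n"
  shows "infsum f UNIV = 0"
proof -
  have "infsum f UNIV = (\<Sum>\<^sub>\<infinity>n. - f n)"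
    by (rule infsum_reindex_bij_witness[of _ "\<lambda>n. c - n" "\<lambda>n. c - n"]) (auto simp: assms)
  then show ?thesis by (simp add: infsum_uminus)
qed

lemma infsum_reflect:
  fixes f :: "int \<Rightarrow> real"
  shows "infsum f UNIV = (\<Sum>\<^sub>\<infinity>n. f (c - n))"
  by (rule infsum_reindex_bij_witness[of _ "\<lambda>n. c - n" "\<lambda>n. c - n"]) auto

lemma infsum_shift:
  fixes f :: "int \<Rightarrow> real"
  shows "infsum f UNIV = (\<Sum>\<^sub>\<infinity>n. f (n + c))"
  by (rule infsum_reindex_bij_witness[of _ "\<lambda>n. n + c" "\<lambda>n. n - c"]) auto

lemma power_int_le_decreasing:
  fixes q :: real
  assumes "0 < q" "q < 1" "m \<le> n"
  shows "q powi n \<le> q powi m"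
  using assms by (intro power_int_decreasing) auto

section \<open>Convergence of the theta series\<close>

lemma summable_theta:
  fixes q :: real
  assumes "0 < q" "q < 1"
  shows "(\<lambda>n. q powi n\<^sup>2) summable_on UNIV" "(\<lambda>n. alt n * q powi n\<^sup>2) summable_on UNIV"
    "(\<lambda>n. q powi tri n) summable_on UNIV"
proof -
  show a: "(\<lambda>n. q powi n\<^sup>2) summable_on UNIV"
  proof (rule summable_on_bound[OF summable_geometric_int[OF assms]])
    show "\<bar>q powi n\<^sup>2\<bar> \<le> q powi \<bar>n\<bar>" for n
      using power_int_le_decreasing[OF assms abs_le_power2[of n]] assms by simp
  qed
  show "(\<lambda>n. alt n * q powi n\<^sup>2) summable_on UNIV"
    by (rule summable_on_bound[OF a]) (use assms in \<open>auto simp: abs_mult abs_alt\<close>)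
  have "q powi tri n \<le> 1 / q * q powi \<bar>n\<bar>" for n
    using power_int_le_decreasing[OF assms tri_ge[of n]] assms by (simp add: power_int_diff)
  then show "(\<lambda>n. q powi tri n) summable_on UNIV"
    using assms
    by (intro summable_on_mult_bound[OF summable_geometric_int[OF assms], of _ "1 / q"]) auto
qed

lemma abs_le_two_powi: "\<bar>real_of_int (2 * n + 1)\<bar> \<le> 3 * 2 powi \<bar>n\<bar>"
proof -
  have "real k \<le> 2 ^ k" for k using of_nat_mono[OF less_imp_le[OF less_exp[of k]]] by simp
  from this[of "nat \<bar>n\<bar>"] have "\<bar>real_of_int n\<bar> \<le> 2 powi \<bar>n\<bar>"
    by (simp add: power_int_nonneg_exp)
  moreover have "(1::real) \<le> 2 powi \<bar>n\<bar>" by (simp add: power_int_nonneg_exp)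
  ultimately show ?thesis by linarith
qed

text \<open>The linear factor is at most a multiple of \<open>2 powi |n|\<close>, which leaves a
  geometric majorant of ratio 2q < 1. Small q suffice, since the identities only serve to compare
  coefficients near q = 0.\<close>

lemma summable_theta_deriv:
  fixes q :: real
  assumes "0 < q" "q < 1/4"
  shows "(\<lambda>n. alt n * real_of_int (2 * n + 1) * q powi tri n) summable_on UNIV"
proof (rule summable_on_mult_bound[of "\<lambda>n. (2 * q) powi \<bar>n\<bar>" _ _ "3 / q"])
  show "(\<lambda>n. (2 * q) powi \<bar>n\<bar>) summable_on UNIV" using assms by (intro summable_geometric_int) auto
  fix n :: int
  have q: "q powi tri n \<le> 1 / q * q powi \<bar>n\<bar>"
    using power_int_le_decreasing[OF _ _ tri_ge[of n], of q] assms by (simp add: power_int_diff)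
  have "\<bar>alt n * real_of_int (2 * n + 1) * q powi tri n\<bar> = \<bar>real_of_int (2 * n + 1)\<bar> * q powi tri n"
    using assms by (simp add: abs_mult abs_alt)
  also have "\<dots> \<le> (3 * 2 powi \<bar>n\<bar>) * (1 / q * q powi \<bar>n\<bar>)"
    using assms q abs_le_two_powi[of n] by (intro mult_mono) auto
  also have "\<dots> = 3 / q * (2 * q) powi \<bar>n\<bar>" by (simp add: power_int_mult_distrib)
  finally show "\<bar>alt n * real_of_int (2 * n + 1) * q powi tri n\<bar> \<le> 3 / q * (2 * q) powi \<bar>n\<bar>" .
qed

text \<open>\<open>phim q\<close> stands for \<open>phi(-q)\<close>. The series \<open>psi2\<close> and \<open>cube2\<close> run over all integers; as the
  terms at \<open>n\<close> and \<open>-1-n\<close> agree, they are twice the corresponding series over the naturals.\<close>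

definition phi :: "real \<Rightarrow> real" where "phi q = (\<Sum>\<^sub>\<infinity>n. q powi n\<^sup>2)"
definition phim :: "real \<Rightarrow> real" where "phim q = (\<Sum>\<^sub>\<infinity>n. alt n * q powi n\<^sup>2)"
definition psi2 :: "real \<Rightarrow> real" where "psi2 q = (\<Sum>\<^sub>\<infinity>n. q powi tri n)"
definition cube2 :: "real \<Rightarrow> real" where
  "cube2 q = (\<Sum>\<^sub>\<infinity>n. alt n * real_of_int (2 * n + 1) * q powi tri n)"

section \<open>Lattice rotations and limits at zero\<close>

lemma half_sum_diff_even:
  fixes x y :: int
  assumes "even x = even y"
  shows "(x + y) div 2 + (x - y) div 2 = x" "(x + y) div 2 - (x - y) div 2 = y"
proof -
  have "even (x - y)" using assms by simp
  then obtain k where "x - y = 2 * k" by (elim evenE)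
  then have "x = y + 2 * k" "(x + y) div 2 = y + k" "(x - y) div 2 = k" by simp_all
  then show "(x + y) div 2 + (x - y) div 2 = x" "(x + y) div 2 - (x - y) div 2 = y" by linarith+
qed

lemma half_sum_diff_odd:
  fixes x y :: int
  assumes "even x \<noteq> even y"
  shows "(x + y) div 2 + (x - y) div 2 + 1 = x" "(x + y) div 2 - (x - y) div 2 = y"
proof -
  have "odd (x - y)" using assms by simp
  then obtain k where "x - y = 2 * k + 1" by (elim oddE)
  then have "x = y + 2 * k + 1" "(x + y) div 2 = y + k" "(x - y) div 2 = k" by simp_all
  then show "(x + y) div 2 + (x - y) div 2 + 1 = x" "(x + y) div 2 - (x - y) div 2 = y" by linarith+
qed

text \<open>Pairs of equal parity are the image of the whole lattice under (u, v) -> (u + v, u - v),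
  a rotation up to scale; pairs of opposite parity are this image shifted by (1, 0).\<close>

lemma infsum_pairs_rotate:
  fixes h :: "int \<times> int \<Rightarrow> real"
  assumes "h summable_on UNIV"
  shows "infsum h UNIV = (\<Sum>\<^sub>\<infinity>(u, v). h (u + v, u - v)) + (\<Sum>\<^sub>\<infinity>(u, v). h (u + v + 1, u - v))"
proof -
  let ?E = "{(x :: int, y). even (x - y)}" and ?O = "{(x :: int, y). odd (x - y)}"
  have "infsum h (?E \<union> ?O) = infsum h ?E + infsum h ?O"
    by (rule infsum_Un_disjoint) (auto intro: summable_on_subset[OF assms])
  also have "?E \<union> ?O = UNIV" by auto
  also have "infsum h ?E = (\<Sum>\<^sub>\<infinity>(u, v). h (u + v, u - v))"
    by (rule infsum_reindex_bij_witness[of _ "\<lambda>(u, v). (u + v, u - v)"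
          "\<lambda>(x, y). ((x + y) div 2, (x - y) div 2)"])
       (auto simp: half_sum_diff_even)
  also have "infsum h ?O = (\<Sum>\<^sub>\<infinity>(u, v). h (u + v + 1, u - v))"
    by (rule infsum_reindex_bij_witness[of _ "\<lambda>(u, v). (u + v + 1, u - v)"
          "\<lambda>(x, y). ((x + y) div 2, (x - y) div 2)"])
       (auto simp: half_sum_diff_odd)
  finally show ?thesis .
qed

lemma square_powi:
  fixes q :: real
  shows "q\<^sup>2 powi n = q powi (2 * n)"
  by (simp add: power_int_power)

text \<open>On the equal-parity coset the exponent becomes 2 u^2 + 2 v^2 and the sign
  \<open>alt u * alt v\<close>, which factors. The other coset contributes 0.\<close>

lemma phi_mult_phim:
  assumes "0 < q" "q < 1"
  shows "phi q * phim q = (phim (q\<^sup>2))\<^sup>2"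
proof -
  define h where "h = (\<lambda>(x, y). q powi x\<^sup>2 * (alt y * q powi y\<^sup>2))"
  have q2: "0 < q\<^sup>2" "q\<^sup>2 < 1" using assms by (auto simp: power_less_one_iff)
  have hs: "(h has_sum phi q * phim q) UNIV"
    using has_sum_product[OF summable_theta(1,2)[OF assms]]
    unfolding h_def phi_def phim_def by simp
  have "phi q * phim q = (\<Sum>\<^sub>\<infinity>(u, v). h (u + v, u - v)) + (\<Sum>\<^sub>\<infinity>(u, v). h (u + v + 1, u - v))"
    using infsum_pairs_rotate[OF has_sum_imp_summable[OF hs]] infsumI[OF hs] by simp
  also have "(\<Sum>\<^sub>\<infinity>(u, v). h (u + v, u - v))
      = (\<Sum>\<^sub>\<infinity>(u, v). (alt u * q\<^sup>2 powi u\<^sup>2) * (alt v * q\<^sup>2 powi v\<^sup>2))"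
  proof (intro infsum_cong, safe)
    fix u v :: int
    have "q powi (u + v)\<^sup>2 * q powi (u - v)\<^sup>2 = q powi (2 * u\<^sup>2) * q powi (2 * v\<^sup>2)"
      using assms by (simp flip: power_int_add) (simp add: power2_eq_square algebra_simps)
    then show "h (u + v, u - v) = (alt u * q\<^sup>2 powi u\<^sup>2) * (alt v * q\<^sup>2 powi v\<^sup>2)"
      by (simp add: h_def square_powi alt_diff)
  qed
  also have "\<dots> = (phim (q\<^sup>2))\<^sup>2"
    using infsumI[OF has_sum_product[OF summable_theta(2,2)[OF q2]]]
    by (simp add: phim_def power2_eq_square)
  \<comment> \<open>The map v -> -1 - v exchanges the two coordinates. They have opposite parity, so
    the sign, which depends on the second coordinate only, flips.\<close>
  also have "(\<Sum>\<^sub>\<infinity>(u, v). h (u + v + 1, u - v)) = (\<Sum>\<^sub>\<infinity>(u, v). - h (u + v + 1, u - v))"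
    by (rule infsum_reindex_bij_witness[of _ "\<lambda>(u, v). (u, - 1 - v)" "\<lambda>(u, v). (u, - 1 - v)"])
       (auto simp: h_def alt_def algebra_simps)
  then have "(\<Sum>\<^sub>\<infinity>(u, v). h (u + v + 1, u - v)) = 0"
    by (simp add: infsum_uminus case_prod_unfold)
  finally show ?thesis by simp
qed

text \<open>This is psi(q)^2 = phi(q) psi(q^2). By \<open>tri_add_diff\<close> the equal-parity
  coset gives \<open>phi q * psi2 (q^2)\<close>; reflecting one argument of \<open>tri\<close> shows
  that the other coset gives the same.\<close>

lemma psi2_square:
  assumes "0 < q" "q < 1"
  shows "(psi2 q)\<^sup>2 = 2 * phi q * psi2 (q\<^sup>2)"
proof -
  define h where "h = (\<lambda>(x, y). q powi tri x * q powi tri y)"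
  have q2: "0 < q\<^sup>2" "q\<^sup>2 < 1" using assms by (auto simp: power_less_one_iff)
  have hs: "(h has_sum psi2 q * psi2 q) UNIV"
    using has_sum_product[OF summable_theta(3,3)[OF assms]]
    unfolding h_def psi2_def by simp
  have h: "h (x, y) = q powi (tri x + tri y)" for x y
    using assms by (simp add: h_def power_int_add)
  have "psi2 q * psi2 q = (\<Sum>\<^sub>\<infinity>(u, v). h (u + v, u - v)) + (\<Sum>\<^sub>\<infinity>(u, v). h (u + v + 1, u - v))"
    using infsum_pairs_rotate[OF has_sum_imp_summable[OF hs]] infsumI[OF hs] by simp
  also have "(\<Sum>\<^sub>\<infinity>(u, v). h (u + v, u - v)) = (\<Sum>\<^sub>\<infinity>(u, v). q\<^sup>2 powi tri u * q powi v\<^sup>2)"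
    using assms by (intro infsum_cong) (auto simp: h tri_add_diff square_powi power_int_add)
  also have "\<dots> = psi2 (q\<^sup>2) * phi q"
    using infsumI[OF has_sum_product[OF summable_theta(3)[OF q2] summable_theta(1)[OF assms]]]
    by (simp add: psi2_def phi_def)
  also have "(\<Sum>\<^sub>\<infinity>(u, v). h (u + v + 1, u - v)) = (\<Sum>\<^sub>\<infinity>(w, v). q\<^sup>2 powi tri w * q powi v\<^sup>2)"
  proof (rule infsum_reindex_bij_witness[of _ "\<lambda>(w, v). (v - 1, w)" "\<lambda>(u, v). (v, u + 1)"]; clarsimp)
    fix u v :: int
    have "tri (v + (u + 1)) + tri (v - (u + 1)) = (u + 1)\<^sup>2 + 2 * tri v" by (rule tri_add_diff)
    moreover have "tri (v - (u + 1)) = tri (u - v)" using tri_reflect[of "u - v"] by (simp add: algebra_simps)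
    ultimately have "tri (u + v + 1) + tri (u - v) = 2 * tri v + (u + 1)\<^sup>2" by (simp add: algebra_simps)
    then show "q\<^sup>2 powi tri v * q powi (u + 1)\<^sup>2 = h (u + v + 1, u - v)"
      using assms by (simp add: h square_powi power_int_add)
  qed
  also have "\<dots> = psi2 (q\<^sup>2) * phi q"
    using infsumI[OF has_sum_product[OF summable_theta(3)[OF q2] summable_theta(1)[OF assms]]]
    by (simp add: psi2_def phi_def)
  finally show ?thesis by (simp add: power2_eq_square)
qed

text \<open>After the rotation the exponent is even in v, so averaging over v and -v removes v from
  the linear factor: 2(u + v) + 1 and 2(u - v) + 1 have mean 2u + 1. What remains factors.\<close>

lemma cube2_mult_psi2:
  assumes "0 < q" "q < 1/4"
  shows "cube2 q * psi2 q = 2 * cube2 (q\<^sup>2) * phim q"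
proof -
  define c where "c x = alt x * real_of_int (2 * x + 1)" for x
  define h where "h = (\<lambda>(x, y). (c x * q powi tri x) * q powi tri y)"
  \<comment> \<open>Both cosets carry this family: the first directly, the second after (u, v) ->
    (v, u + 1), by the reflection symmetry of \<open>tri\<close>.\<close>
  define H where "H = (\<lambda>(u, v). c (u + v) * q powi (2 * tri u + v\<^sup>2))"
  have q1: "q < 1" using assms by simp
  have "q\<^sup>2 < q * 1" using assms unfolding power2_eq_square by (intro mult_strict_left_mono) auto
  then have q2: "0 < q\<^sup>2" "q\<^sup>2 < 1/4" using assms by auto
  have hs: "(h has_sum cube2 q * psi2 q) UNIV"
    using has_sum_product[OF summable_theta_deriv[OF assms] summable_theta(3)[OF assms(1) q1]]
    unfolding h_def psi2_def cube2_def c_def by simp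
  have h: "h (x, y) = c x * q powi (tri x + tri y)" for x y
    using assms by (simp add: h_def power_int_add)
  have *: "infsum H UNIV = cube2 (q\<^sup>2) * phim q" if H: "H summable_on UNIV"
  proof -
    have r: "(\<Sum>\<^sub>\<infinity>(u, v). H (u, - v)) = infsum H UNIV"
      by (rule infsum_reindex_bij_witness[of _ "\<lambda>(u, v). (u, - v)" "\<lambda>(u, v). (u, - v)"]) auto
    have r': "(\<lambda>(u, v). H (u, - v)) summable_on UNIV"
      using H by (subst summable_on_reindex_bij_witness[of _ "\<lambda>(u, v). (u, - v)" "\<lambda>(u, v). (u, - v)" UNIV H]) auto
    have "2 * infsum H UNIV = infsum H UNIV + (\<Sum>\<^sub>\<infinity>(u, v). H (u, - v))" using r by simp
    also have "\<dots> = (\<Sum>\<^sub>\<infinity>p. H p + (case p of (u, v) \<Rightarrow> H (u, - v)))"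
      by (rule infsum_add[symmetric, OF H r'])
    also have "\<dots> = (\<Sum>\<^sub>\<infinity>p. 2 * (case p of (u, v) \<Rightarrow> (c u * q\<^sup>2 powi tri u) * (alt v * q powi v\<^sup>2)))"
    proof (intro infsum_cong, clarify)
      fix u v :: int
      have "c (u + v) + c (u - v) = 2 * (c u * alt v)"
        by (simp add: c_def alt_add alt_diff) (simp add: algebra_simps)
      then show "H (u, v) + H (u, - v) = 2 * ((c u * q\<^sup>2 powi tri u) * (alt v * q powi v\<^sup>2))"
        using assms by (simp add: H_def square_powi power_int_add flip: distrib_right)
    qed
    also have "\<dots> = 2 * (cube2 (q\<^sup>2) * phim q)"
      using infsumI[OF has_sum_product[OF summable_theta_deriv[OF q2] summable_theta(2)[OF assms(1) q1]]]
      by (simp add: infsum_cmult_right' cube2_def phim_def c_def)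
    finally show ?thesis by simp
  qed
  have s: "h summable_on UNIV" using hs by (rule has_sum_imp_summable)
  have e1: "h (u + v, u - v) = H (u, v)" for u v
    by (simp only: h H_def prod.case tri_add_diff add.commute[of "v\<^sup>2"])
  have e2: "h (u + v + 1, u - v) = H (v, u + 1)" for u v
  proof -
    have "tri (v + (u + 1)) + tri (v - (u + 1)) = (u + 1)\<^sup>2 + 2 * tri v" by (rule tri_add_diff)
    moreover have "tri (v - (u + 1)) = tri (u - v)" using tri_reflect[of "u - v"] by (simp add: algebra_simps)
    ultimately have "tri (u + v + 1) + tri (u - v) = 2 * tri v + (u + 1)\<^sup>2" by (simp add: algebra_simps)
    then show ?thesis by (simp add: h H_def ac_simps)
  qed
  \<comment> \<open>\<open>H\<close> is a reindexing of \<open>h\<close> on the pairs of equal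
    parity and inherits its summability.\<close>
  have "h summable_on {(x, y). even (x - y)}" by (rule summable_on_subset[OF s]) simp
  moreover have "H summable_on UNIV \<longleftrightarrow> h summable_on {(x, y). even (x - y)}"
    by (rule summable_on_reindex_bij_witness[of _ "\<lambda>(x, y). ((x + y) div 2, (x - y) div 2)" "\<lambda>(u, v). (u + v, u - v)"])
       (auto simp: e1 half_sum_diff_even)
  ultimately have H: "H summable_on UNIV" by simp
  have "cube2 q * psi2 q = (\<Sum>\<^sub>\<infinity>(u, v). h (u + v, u - v)) + (\<Sum>\<^sub>\<infinity>(u, v). h (u + v + 1, u - v))"
    using infsum_pairs_rotate[OF s] infsumI[OF hs] by simp
  also have "(\<Sum>\<^sub>\<infinity>(u, v). h (u + v, u - v)) = infsum H UNIV"
    by (intro infsum_cong) (auto simp: e1)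
  also have "(\<Sum>\<^sub>\<infinity>(u, v). h (u + v + 1, u - v)) = infsum H UNIV"
    by (rule infsum_reindex_bij_witness[of _ "\<lambda>(w, v). (v - 1, w)" "\<lambda>(u, v). (v, u + 1)"])
       (auto simp: e2)
  finally show ?thesis using *[OF H] by simp
qed

section \<open>Limits of series as q tends to 0 from the right\<close>

lemma tendsto_infsum_at_0:
  fixes g :: "real \<Rightarrow> 'a \<Rightarrow> real"
  assumes g: "\<And>q. 0 < q \<Longrightarrow> q < r \<Longrightarrow> g q summable_on A" and l: "l summable_on A"
    and B: "B summable_on A" and r: "0 < r"
    and bound: "\<And>q x. 0 < q \<Longrightarrow> q < r \<Longrightarrow> x \<in> A \<Longrightarrow> \<bar>g q x - l x\<bar> \<le> q * B x"
  shows "((\<lambda>q. infsum (g q) A) \<longlongrightarrow> infsum l A) (at_right 0)"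
proof -
  have ev: "eventually (\<lambda>q. norm (infsum (g q) A - infsum l A) \<le> q * infsum B A) (at_right 0)"
    unfolding eventually_at_right_field
  proof (intro exI[of _ r] conjI r allI impI)
    fix q assume q: "0 < q" "q < r"
    have d: "(\<lambda>x. g q x - l x) summable_on A" 
      using summable_on_add[OF g[OF q] iffD2[OF summable_on_uminus l]] by simp
    have ad: "(\<lambda>x. norm (g q x - l x)) summable_on A"
      by (rule summable_on_iff_abs_summable_on_real[THEN iffD1, OF d])
    have "infsum (g q) A - infsum l A = (\<Sum>\<^sub>\<infinity>x\<in>A. g q x - l x)"
      using infsum_add[OF g[OF q] iffD2[OF summable_on_uminus l]] by (simp add: infsum_uminus)
    also have "norm \<dots> \<le> (\<Sum>\<^sub>\<infinity>x\<in>A. norm (g q x - l x))"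
      by (rule norm_infsum_bound[OF ad])
    also have "\<dots> \<le> (\<Sum>\<^sub>\<infinity>x\<in>A. q * B x)"
      by (rule infsum_mono[OF ad summable_on_cmult_right[OF B]]) (use bound[OF q] in simp)
    also have "\<dots> = q * infsum B A" by (rule infsum_cmult_right') 
    finally show "norm (infsum (g q) A - infsum l A) \<le> q * infsum B A" .
  qed
  have "((\<lambda>q. q * infsum B A) \<longlongrightarrow> 0 * infsum B A) (at_right 0)"
    by (intro tendsto_intros)
  then have "((\<lambda>q. infsum (g q) A - infsum l A) \<longlongrightarrow> 0) (at_right 0)"
    using Lim_null_comparison[OF ev] by simp
  then show ?thesis using LIM_zero_iff by blast
qed

text \<open>Only terms with exponent 0 survive. Every other exponent is at least 1, so one factor q
  splits off and the rest is dominated by the series at r.\<close>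

lemma tendsto_theta_at_0:
  fixes w :: "'a \<Rightarrow> real" and N :: "'a \<Rightarrow> int"
  assumes r: "0 < r" "r < 1" and N: "\<And>x. N x \<ge> 0" and s: "(\<lambda>x. w x * r powi N x) summable_on UNIV"
    and Z: "{x. N x = 0} = Z" "finite Z"
  shows "((\<lambda>q. \<Sum>\<^sub>\<infinity>x. w x * q powi N x) \<longlongrightarrow> sum w Z) (at_right 0)"
proof -
  define l where "l x = (if N x = 0 then w x else 0)" for x
  define B where "B x = \<bar>w x * r powi N x\<bar> / r" for x
  have abs: "(\<lambda>x. \<bar>w x * r powi N x\<bar>) summable_on UNIV"
    using summable_on_iff_abs_summable_on_real[THEN iffD1, OF s] by simp
  have "l summable_on UNIV \<longleftrightarrow> w summable_on Z"
    using Z by (intro summable_on_cong_neutral) (auto simp: l_def)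
  then have l: "l summable_on UNIV" using Z by simp
  have "infsum l UNIV = infsum w Z"
    using Z by (intro infsum_cong_neutral) (auto simp: l_def)
  also have "\<dots> = sum w Z" using Z by simp
  finally have li: "infsum l UNIV = sum w Z" .
  have mono: "q powi N x \<le> r powi N x" if "0 < q" "q < r" for q x
    using that N[of x] by (intro power_int_mono) auto
  have "((\<lambda>q. \<Sum>\<^sub>\<infinity>x. w x * q powi N x) \<longlongrightarrow> infsum l UNIV) (at_right 0)"
  proof (rule tendsto_infsum_at_0[OF _ l _ r(1)])
    show "(\<lambda>x. w x * q powi N x) summable_on UNIV" if "0 < q" "q < r" for q
      by (rule summable_on_bound[OF abs])
         (use that mono[OF that] r in \<open>auto simp: abs_mult intro!: mult_left_mono\<close>)
    show "B summable_on UNIV"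
      unfolding B_def using abs by (simp add: divide_inverse summable_on_cmult_left)
    fix q x assume q: "0 < q" "q < r"
    show "\<bar>w x * q powi N x - l x\<bar> \<le> q * B x"
    proof (cases "N x = 0")
      case True
      then show ?thesis using q r by (simp add: l_def B_def)
    next
      case False
      then have N1: "N x - 1 \<ge> 0" using N[of x] by simp
      have "q powi N x = q * q powi (N x - 1)" using q by (simp add: power_int_diff)
      also have "\<dots> \<le> q * r powi (N x - 1)"
        using q N1 by (intro mult_left_mono power_int_mono) auto
      also have "\<dots> = q * (r powi N x / r)" using r by (simp add: power_int_diff)
      finally have "\<bar>w x\<bar> * q powi N x \<le> \<bar>w x\<bar> * (q * (r powi N x / r))"
        by (rule mult_left_mono) simp
      then show ?thesis using False q r by (simp add: l_def B_def abs_mult mult_ac)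
    qed
  qed
  then show ?thesis by (simp add: li)
qed

text \<open>Repeated squaring yields the points \<open>q ^ (2 ^ n)\<close>, which tend to 0 and
  along which f is constant.\<close>

lemma eq_limit_if_square_invariant:
  fixes f :: "real \<Rightarrow> real"
  assumes inv: "\<And>q. 0 < q \<Longrightarrow> q < 1/4 \<Longrightarrow> f q = f (q\<^sup>2)"
    and lim: "(f \<longlongrightarrow> L) (at_right 0)" and q: "0 < q" "q < 1/4"
  shows "f q = L"
proof -
  define s where "s n = q ^ (2 ^ n)" for n
  have s: "0 < s n \<and> s n < 1/4" for n
  proof -
    have "q ^ (2 ^ n) \<le> q ^ 1" using q by (intro power_decreasing) auto
    then show ?thesis using q unfolding s_def by auto
  qed
  have fs: "f (s n) = f q" for n
  proof (induction n)
    case (Suc n)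
    have "s (Suc n) = (s n)\<^sup>2" by (simp add: s_def power_mult mult.commute flip: power_mult)
    then show ?case using inv[of "s n"] s[of n] Suc by simp
  qed (simp add: s_def)
  have "s \<longlonglongrightarrow> 0"
  proof (rule tendsto_sandwich[OF _ _ tendsto_const])
    show "eventually (\<lambda>n. 0 \<le> s n) sequentially" using s by (intro always_eventually) (auto intro: less_imp_le)
    show "eventually (\<lambda>n. s n \<le> q ^ n) sequentially"
      unfolding s_def using q by (auto intro!: always_eventually power_decreasing less_imp_le[OF less_exp])
    show "(\<lambda>n. q ^ n) \<longlonglongrightarrow> 0" using q by (intro LIMSEQ_realpow_zero) auto
  qed
  then have "filterlim s (at_right 0) sequentially"
    unfolding filterlim_at using s by (intro conjI always_eventually allI) (simp_all add: order_less_imp_not_eq2)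
  then have "(\<lambda>n. f (s n)) \<longlonglongrightarrow> L" by (rule filterlim_compose[OF lim])
  then show ?thesis by (simp add: fs LIMSEQ_const_iff)
qed

section \<open>The cube of the eta function and the square of phi\<close>

lemma tri_eq_0_iff: "tri n = 0 \<longleftrightarrow> n \<in> {0, -1}"
proof
  assume "tri n = 0"
  then have "n * (n + 1) = 0" using tri_double[of n] by simp
  then show "n \<in> {0, -1}" by auto
qed (auto simp: tri_def)

lemma phim_at_0: "(phim \<longlongrightarrow> 1) (at_right 0)"
proof -
  have "(phim \<longlongrightarrow> sum alt {0}) (at_right 0)"
    unfolding phim_def
    by (rule tendsto_theta_at_0[where r = "1/4"]) (auto intro: summable_theta)
  then show ?thesis by (simp add: alt_def)
qed

lemma psi2_at_0: "(psi2 \<longlongrightarrow> 2) (at_right 0)"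
proof -
  have "((\<lambda>q::real. \<Sum>\<^sub>\<infinity>n. 1 * q powi tri n) \<longlongrightarrow> sum (\<lambda>n. 1) {0, - 1 :: int}) (at_right 0)"
    by (rule tendsto_theta_at_0[where r = "1/4"])
       (auto intro: summable_theta simp: tri_nonneg tri_eq_0_iff)
  moreover have "psi2 = (\<lambda>q. \<Sum>\<^sub>\<infinity>n. 1 * q powi tri n)" by (simp add: psi2_def fun_eq_iff)
  ultimately show ?thesis by simp
qed

lemma cube2_at_0: "(cube2 \<longlongrightarrow> 2) (at_right 0)"
proof -
  have "(cube2 \<longlongrightarrow> sum (\<lambda>n. alt n * real_of_int (2 * n + 1)) {0, - 1 :: int}) (at_right 0)"
    unfolding cube2_def
    by (rule tendsto_theta_at_0[where r = "1/5"])
       (use summable_theta_deriv[of "1/5"] in \<open>auto simp: tri_nonneg tri_eq_0_iff\<close>)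
  then show ?thesis by (simp add: alt_def)
qed

lemma phi_pos:
  assumes "0 < q" "q < 1"
  shows "phi q > 0"
proof -
  have "sum (\<lambda>n. q powi n\<^sup>2) {0} \<le> phi q"
    unfolding phi_def using assms by (intro finite_sum_le_infsum summable_theta) auto
  then show ?thesis by simp
qed

lemma psi2_pos:
  assumes "0 < q" "q < 1"
  shows "psi2 q > 0"
proof -
  have "sum (\<lambda>n. q powi tri n) {0} \<le> psi2 q"
    unfolding psi2_def using assms by (intro finite_sum_le_infsum summable_theta) auto
  then show ?thesis by (simp add: tri_def)
qed

lemma square_lt_quarter:
  fixes q :: real
  assumes "0 < q" "q < 1/4"
  shows "0 < q\<^sup>2" "q\<^sup>2 < 1/4"
proof -
  have "q\<^sup>2 < q * 1" using assms unfolding power2_eq_square by (intro mult_strict_left_mono) auto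
  then show "0 < q\<^sup>2" "q\<^sup>2 < 1/4" using assms by auto
qed

text \<open>As \<open>phi\<close> is positive, \<open>phi_mult_phim\<close> shows that
  \<open>phim\<close> vanishes at q exactly when it vanishes at q^2. The indicator f of nonvanishing
  is therefore invariant under squaring, and it is 1 near 0.\<close>

lemma phim_nonzero:
  assumes "0 < q" "q < 1/4"
  shows "phim q \<noteq> 0"
proof -
  define f :: "real \<Rightarrow> real" where "f q = (if phim q = 0 then 0 else 1)" for q
  have "f q = 1"
  proof (rule eq_limit_if_square_invariant[OF _ _ assms])
    show "f q = f (q\<^sup>2)" if "0 < q" "q < 1/4" for q
      using phi_mult_phim[of q] phi_pos[of q] that by (auto simp: f_def)
    have "eventually (\<lambda>q. phim q > 0) (at_right 0)"
      using phim_at_0 by (rule order_tendstoD) simp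
    then have "eventually (\<lambda>q. 1 = f q) (at_right 0)"
      by eventually_elim (simp add: f_def)
    then show "(f \<longlongrightarrow> 1) (at_right 0)" by (rule Lim_transform_eventually[OF tendsto_const])
  qed
  then show ?thesis by (auto simp: f_def)
qed

text \<open>Jacobi's series for the cube of the Euler product. The three rotation formulas show that
  passing from q to q^2 multiplies both sides by the same factor
  \<open>psi2 q / (2 * phim q)\<close>.\<close>

theorem cube2_eq:
  assumes "0 < q" "q < 1/4"
  shows "cube2 q = (phim q)\<^sup>2 * psi2 q"
proof -
  define f where "f q = cube2 q / ((phim q)\<^sup>2 * psi2 q)" for q
  have "f q = 2 / (1\<^sup>2 * 2)"
  proof (rule eq_limit_if_square_invariant[OF _ _ assms])
    fix q :: real assume q: "0 < q" "q < 1/4"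
    have q1: "q < 1" using q by simp
    note q2 = square_lt_quarter[OF q]
    have pos: "psi2 q > 0" "psi2 (q\<^sup>2) > 0" "phi q > 0" "phim q \<noteq> 0" "phim (q\<^sup>2) \<noteq> 0"
      using q q2 by (auto intro: psi2_pos phi_pos simp: phim_nonzero)
    have "(phim (q\<^sup>2))\<^sup>2 * psi2 (q\<^sup>2) = phim q * (psi2 q)\<^sup>2 / 2"
      unfolding psi2_square[OF q(1) q1] phi_mult_phim[OF q(1) q1, symmetric] by simp
    then have "f (q\<^sup>2) = 2 * cube2 (q\<^sup>2) * phim q / ((phim q)\<^sup>2 * (psi2 q)\<^sup>2)"
      using pos by (simp add: f_def field_simps power2_eq_square)
    also have "\<dots> = f q"
      unfolding cube2_mult_psi2[OF q, symmetric] f_def using pos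
      by (simp add: field_simps power2_eq_square)
    finally show "f q = f (q\<^sup>2)" ..
    next
    show "(f \<longlongrightarrow> 2 / (1\<^sup>2 * 2)) (at_right 0)"
      unfolding f_def by (intro tendsto_intros cube2_at_0 phim_at_0 psi2_at_0) simp
  qed
  then show ?thesis
    using phim_nonzero[OF assms] psi2_pos[of q] assms by (simp add: f_def)
qed

section \<open>The Lambert series with terms x / (1 + x^2), x = q^n, and the square of phi\<close>

definition kern :: "real \<Rightarrow> int \<Rightarrow> real" where
  "kern q n = 1 / (q powi n + q powi (- n))"

definition ell :: "real \<Rightarrow> real" where "ell q = (\<Sum>\<^sub>\<infinity>n. kern q n)"
definition ellm :: "real \<Rightarrow> real" where "ellm q = (\<Sum>\<^sub>\<infinity>n. alt n * kern q n)"

lemma kern_nonneg: "0 < q \<Longrightarrow> 0 \<le> kern q n"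
  by (simp add: kern_def)

lemma kern_mult: "0 < q \<Longrightarrow> kern q n * (q powi n + q powi (- n)) = 1"
  by (simp add: kern_def add_pos_pos less_imp_neq[symmetric])

lemma kern_minus: "kern q (- n) = kern q n"
  by (simp add: kern_def add.commute)

lemma kern_le:
  assumes "0 < q"
  shows "kern q n \<le> q powi \<bar>n\<bar>"
proof -
  have "q powi (- \<bar>n\<bar>) \<le> q powi n + q powi (- n)"
    using assms by (cases "n \<ge> 0") auto
  then have "kern q n \<le> 1 / q powi (- \<bar>n\<bar>)"
    unfolding kern_def using assms by (intro divide_left_mono) (auto simp: add_pos_pos)
  then show ?thesis by (simp add: power_int_minus field_simps)
qed

lemma summable_kern:
  assumes "0 < q" "q < 1"
  shows "kern q summable_on UNIV" "(\<lambda>n. alt n * kern q n) summable_on UNIV"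
proof -
  show "kern q summable_on UNIV"
    by (rule summable_on_bound[OF summable_geometric_int[OF assms]])
       (use assms kern_nonneg kern_le in auto)
  show "(\<lambda>n. alt n * kern q n) summable_on UNIV"
    by (rule summable_on_bound[OF summable_geometric_int[OF assms]])
       (use assms kern_nonneg kern_le in \<open>auto simp: abs_mult abs_alt\<close>)
qed

text \<open>Multiplied by \<open>q powi k^2\<close>, this is the convolution at k of the signed
  kernel with the squares; see \<open>appell_eq\<close>.\<close>

definition appell :: "real \<Rightarrow> int \<Rightarrow> real" where
  "appell q k = (\<Sum>\<^sub>\<infinity>n. alt n * q powi (n\<^sup>2 - 2 * n * k) * kern q n)"

lemma summable_appell:
  assumes "0 < q" "q < 1"
  shows "(\<lambda>n. alt n * q powi (n\<^sup>2 - n * k) * kern q n) summable_on UNIV"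
proof (rule summable_on_mult_bound[OF summable_geometric_int[OF assms]])
  fix n :: int
  have "- k\<^sup>2 \<le> n\<^sup>2 - n * k"
  proof -
    have "0 \<le> (n - k)\<^sup>2 + n\<^sup>2 + k\<^sup>2" by simp
    then show ?thesis by (simp add: power2_eq_square algebra_simps)
  qed
  then have "q powi (n\<^sup>2 - n * k) \<le> q powi (- k\<^sup>2)"
    by (rule power_int_le_decreasing[OF assms])
  then have "q powi (n\<^sup>2 - n * k) * kern q n \<le> q powi (- k\<^sup>2) * q powi \<bar>n\<bar>"
    using assms kern_nonneg kern_le by (intro mult_mono) auto
  then show "\<bar>alt n * q powi (n\<^sup>2 - n * k) * kern q n\<bar> \<le> q powi (- k\<^sup>2) * q powi \<bar>n\<bar>"
    using assms kern_nonneg by (simp add: abs_mult abs_alt)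
qed

lemma powi_kern_telescope:
  assumes "0 < q"
  shows "q powi (m + n) * kern q n + q powi (m - n) * kern q n = q powi m"
proof -
  have "q powi (m + n) * kern q n + q powi (m - n) * kern q n
      = q powi m * (kern q n * (q powi n + q powi (- n)))"
    using assms by (simp add: power_int_add power_int_diff power_int_minus field_simps)
  then show ?thesis using kern_mult[OF assms] by simp
qed

text \<open>Adding two consecutive sums produces the factor \<open>q powi n + q powi (- n)\<close>,
  which cancels the kernel. The remaining exponent n^2 - (2k + 1) n is symmetric under n -> 2k + 1 -
  n, a map that changes the parity of n.\<close>

lemma appell_step:
  assumes "0 < q" "q < 1"
  shows "appell q k + appell q (k + 1) = 0"
proof -
  note s = summable_appell[OF assms, of "2 * k"] summable_appell[OF assms, of "2 * k + 2"]
  have "appell q k + appell q (k + 1) =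
      (\<Sum>\<^sub>\<infinity>n. alt n * q powi (n\<^sup>2 - 2 * n * k) * kern q n + alt n * q powi (n\<^sup>2 - 2 * n * (k + 1)) * kern q n)"
    unfolding appell_def
    by (rule infsum_add[symmetric]) (use s in \<open>simp_all add: algebra_simps\<close>)
  also have "\<dots> = (\<Sum>\<^sub>\<infinity>n. alt n * q powi (n\<^sup>2 - 2 * n * k - n))"
  proof (intro infsum_cong)
    fix n
    show "alt n * q powi (n\<^sup>2 - 2 * n * k) * kern q n + alt n * q powi (n\<^sup>2 - 2 * n * (k + 1)) * kern q n
        = alt n * q powi (n\<^sup>2 - 2 * n * k - n)"
      using arg_cong[OF powi_kern_telescope[OF assms(1), of "n\<^sup>2 - 2 * n * k - n" n], of "\<lambda>x. alt n * x"]
      by (simp add: algebra_simps)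
  qed
  also have "\<dots> = 0"
    by (rule infsum_antisym[where c = "2 * k + 1"]) (simp add: alt_def power2_eq_square algebra_simps)
  finally show ?thesis .
qed

lemma alternating_int_seq:
  fixes f :: "int \<Rightarrow> real"
  assumes "\<And>k. f k + f (k + 1) = 0"
  shows "f k = alt k * f 0"
proof (induction k rule: int_induct[where k = 0])
  case (step1 i)
  then show ?case using assms[of i] by (simp add: alt_def split: if_splits)
next
  case (step2 i)
  then show ?case using assms[of "i - 1"] by (simp add: alt_def split: if_splits)
qed (simp add: alt_def)

lemma appell_eq:
  assumes "0 < q" "q < 1"
  shows "(\<Sum>\<^sub>\<infinity>n. alt n * q powi (n - k)\<^sup>2 * kern q n) = alt k * q powi k\<^sup>2 * appell q 0"
proof -
  have "(\<Sum>\<^sub>\<infinity>n. alt n * q powi (n - k)\<^sup>2 * kern q n)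
      = (\<Sum>\<^sub>\<infinity>n. q powi k\<^sup>2 * (alt n * q powi (n\<^sup>2 - 2 * n * k) * kern q n))"
  proof (intro infsum_cong)
    fix n
    have "(n - k)\<^sup>2 = k\<^sup>2 + (n\<^sup>2 - 2 * n * k)" by (simp add: power2_diff)
    then have "q powi (n - k)\<^sup>2 = q powi k\<^sup>2 * q powi (n\<^sup>2 - 2 * n * k)"
      using power_int_add[of q "k\<^sup>2" "n\<^sup>2 - 2 * n * k"] assms by simp
    then show "alt n * q powi (n - k)\<^sup>2 * kern q n = q powi k\<^sup>2 * (alt n * q powi (n\<^sup>2 - 2 * n * k) * kern q n)"
      by simp
  qed
  also have "\<dots> = q powi k\<^sup>2 * appell q k" by (simp add: infsum_cmult_right' appell_def)
  also have "appell q k = alt k * appell q 0"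
    by (rule alternating_int_seq[where f = "appell q"]) (rule appell_step[OF assms])
  finally show ?thesis by simp
qed

lemma has_sum_convolution:
  fixes f g :: "int \<Rightarrow> real"
  assumes f: "f summable_on UNIV" and g: "g summable_on UNIV"
  shows "((\<lambda>k. \<Sum>\<^sub>\<infinity>n. f n * g (n - k)) has_sum (infsum f UNIV * infsum g UNIV)) UNIV"
proof -
  have "((\<lambda>(k, n). f n * g (n - k)) has_sum (infsum f UNIV * infsum g UNIV)) (UNIV \<times> UNIV)
      \<longleftrightarrow> ((\<lambda>(x, y). f x * g y) has_sum (infsum f UNIV * infsum g UNIV)) (UNIV \<times> UNIV)"
    by (rule has_sum_reindex_bij_witness[of _ "\<lambda>(x, y). (x - y, x)" "\<lambda>(k, n). (n, n - k)"]) auto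
  then have h: "((\<lambda>(k, n). f n * g (n - k)) has_sum (infsum f UNIV * infsum g UNIV)) (UNIV \<times> UNIV)"
    using has_sum_product[OF f g] by simp
  show ?thesis
  proof (rule has_sum_Sigma'[OF h])
    fix k :: int
    have "(\<lambda>n. f n * g (n - k)) summable_on UNIV"
      using summable_on_SigmaD1[OF has_sum_imp_summable[OF h], of k] by simp
    then show "((\<lambda>n. case (k, n) of (k, n) \<Rightarrow> f n * g (n - k)) has_sum (\<Sum>\<^sub>\<infinity>n. f n * g (n - k))) UNIV"
      by simp
  qed
qed

text \<open>Expanding the product as a convolution and using
  \<open>alt (n - k) = alt n * alt k\<close> leads to the sums of \<open>appell_eq\<close>; the two
  signs \<open>alt k\<close> cancel, so \<open>phi\<close> appears. In \<open>ellm_mult_phi\<close>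
  one of them remains and gives \<open>phim\<close>.\<close>

lemma ell_mult_phim:
  assumes "0 < q" "q < 1"
  shows "ell q * phim q = appell q 0 * phi q"
proof -
  have "ell q * phim q = (\<Sum>\<^sub>\<infinity>k. \<Sum>\<^sub>\<infinity>n. kern q n * (alt (n - k) * q powi (n - k)\<^sup>2))"
    using infsumI[OF has_sum_convolution[OF summable_kern(1)[OF assms] summable_theta(2)[OF assms]]]
    by (simp add: ell_def phim_def)
  also have "\<dots> = (\<Sum>\<^sub>\<infinity>k. alt k * (\<Sum>\<^sub>\<infinity>n. alt n * q powi (n - k)\<^sup>2 * kern q n))"
    by (simp add: infsum_cmult_right'[symmetric] alt_diff mult_ac)
  also have "\<dots> = (\<Sum>\<^sub>\<infinity>k. appell q 0 * q powi k\<^sup>2)"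
    by (simp add: appell_eq[OF assms] alt_mult_self flip: mult.assoc) (simp add: mult.commute)
  finally show ?thesis by (simp add: infsum_cmult_right' phi_def)
qed

lemma ellm_mult_phi:
  assumes "0 < q" "q < 1"
  shows "ellm q * phi q = appell q 0 * phim q"
proof -
  have "ellm q * phi q = (\<Sum>\<^sub>\<infinity>k. \<Sum>\<^sub>\<infinity>n. alt n * kern q n * q powi (n - k)\<^sup>2)"
    using infsumI[OF has_sum_convolution[OF summable_kern(2)[OF assms] summable_theta(1)[OF assms]]]
    by (simp add: ellm_def phi_def)
  also have "\<dots> = (\<Sum>\<^sub>\<infinity>k. \<Sum>\<^sub>\<infinity>n. alt n * q powi (n - k)\<^sup>2 * kern q n)"
    by (simp add: mult_ac)
  also have "\<dots> = (\<Sum>\<^sub>\<infinity>k. appell q 0 * (alt k * q powi k\<^sup>2))"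
    unfolding appell_eq[OF assms] by (simp add: mult_ac)
  finally show ?thesis by (simp add: infsum_cmult_right' phim_def)
qed

lemma kern_double: "kern q (2 * n) = kern (q\<^sup>2) n"
  by (simp add: kern_def power_int_power)

text \<open>One double series is summed in two orders. Summing over n first uses
  \<open>appell_eq\<close> at 2k. Summing over k first, odd n vanish by the reflection k -> n - k,
  and even n give the kernel at q^2. The common factor \<open>phim (q ^ 4)\<close> is
  cancelled.\<close>

lemma appell_eq_ellm:
  assumes "0 < q" "q < 1/4"
  shows "appell q 0 = ellm (q\<^sup>2)"
proof -
  have q1: "q < 1" using assms by simp
  define h where "h = (\<lambda>(k, n). alt k * (alt n * q powi (n - 2 * k)\<^sup>2 * kern q n))"
  \<comment> \<open>The pairs (n, n - 2k) are exactly the pairs of equal parity, so summability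
    comes from the full product.\<close>
  have "(\<lambda>(n, m). kern q n * q powi m\<^sup>2) summable_on UNIV"
    using has_sum_imp_summable[OF has_sum_product[OF summable_kern(1) summable_theta(1)]] assms by simp
  then have "(\<lambda>(n, m). kern q n * q powi m\<^sup>2) summable_on {(n, m). even (n - m)}"
    by (rule summable_on_subset) simp
  moreover have "(\<lambda>(k, n). kern q n * q powi (n - 2 * k)\<^sup>2) summable_on UNIV \<longleftrightarrow>
      (\<lambda>(n, m). kern q n * q powi m\<^sup>2) summable_on {(n, m). even (n - m)}"
    by (rule summable_on_reindex_bij_witness[of _ "\<lambda>(n, m). ((n - m) div 2, n)" "\<lambda>(k, n). (n, n - 2 * k)"])
       auto
  ultimately have "(\<lambda>(k, n). kern q n * q powi (n - 2 * k)\<^sup>2) summable_on UNIV" by simp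
  then have "h summable_on UNIV"
    by (rule summable_on_bound)
       (use assms kern_nonneg in \<open>auto simp: h_def abs_mult abs_alt\<close>)
  then have hs: "h summable_on UNIV \<times> UNIV" by simp
  have "(\<Sum>\<^sub>\<infinity>k. \<Sum>\<^sub>\<infinity>n. h (k, n)) = (\<Sum>\<^sub>\<infinity>k. alt k * (alt (2 * k) * q powi (2 * k)\<^sup>2 * appell q 0))"
    using appell_eq[OF assms(1) q1, of "2 * _"] by (simp add: h_def infsum_cmult_right')
  also have "\<dots> = (\<Sum>\<^sub>\<infinity>k. (alt k * (q ^ 4) powi k\<^sup>2) * appell q 0)"
    by (simp add: power_int_power alt_double power_mult_distrib mult.assoc mult.left_commute)
  also have "\<dots> = phim (q ^ 4) * appell q 0" by (simp add: infsum_cmult_left' phim_def)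
  finally have 1: "(\<Sum>\<^sub>\<infinity>k. \<Sum>\<^sub>\<infinity>n. h (k, n)) = phim (q ^ 4) * appell q 0" .
  have inner: "(\<Sum>\<^sub>\<infinity>k. alt k * q powi (n - 2 * k)\<^sup>2) = (if even n then alt (n div 2) * phim (q ^ 4) else 0)" for n
  proof (cases "even n")
    case True
    then obtain m where m: "n = 2 * m" by (elim evenE)
    have "(\<Sum>\<^sub>\<infinity>k. alt k * q powi (n - 2 * k)\<^sup>2) = (\<Sum>\<^sub>\<infinity>k. alt (k + m) * q powi (n - 2 * (k + m))\<^sup>2)"
      by (rule infsum_shift)
    also have "\<dots> = (\<Sum>\<^sub>\<infinity>k. alt m * (alt k * (q ^ 4) powi k\<^sup>2))"
      by (simp add: m alt_add power_int_power power_mult_distrib mult_ac)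
    finally show ?thesis using m by (simp add: infsum_cmult_right' phim_def)
  next
    case False
    have "(\<Sum>\<^sub>\<infinity>k. alt k * q powi (n - 2 * k)\<^sup>2) = 0"
      by (rule infsum_antisym[where c = n]) (use False in \<open>auto simp: alt_def power2_eq_square algebra_simps\<close>)
    then show ?thesis using False by simp
  qed
  have "(\<Sum>\<^sub>\<infinity>k. \<Sum>\<^sub>\<infinity>n. h (k, n)) = (\<Sum>\<^sub>\<infinity>n. \<Sum>\<^sub>\<infinity>k. h (k, n))"
    using hs by (intro infsum_swap_banach) (simp add: case_prod_unfold)
  also have "\<dots> = (\<Sum>\<^sub>\<infinity>n. (alt n * kern q n) * (\<Sum>\<^sub>\<infinity>k. alt k * q powi (n - 2 * k)\<^sup>2))"
    by (simp add: h_def infsum_cmult_right'[symmetric] mult_ac)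
  also have "\<dots> = (\<Sum>\<^sub>\<infinity>n\<in>{n. even n}. kern q n * (alt (n div 2) * phim (q ^ 4)))"
    unfolding inner by (rule infsum_cong_neutral) (auto simp: alt_def)
  also have "\<dots> = (\<Sum>\<^sub>\<infinity>n. alt n * kern (q\<^sup>2) n * phim (q ^ 4))"
    by (rule infsum_reindex_bij_witness[of _ "\<lambda>n. 2 * n" "\<lambda>n. n div 2"])
       (auto simp: kern_double[symmetric])
  also have "\<dots> = ellm (q\<^sup>2) * phim (q ^ 4)" by (simp add: infsum_cmult_left' ellm_def)
  finally have 2: "(\<Sum>\<^sub>\<infinity>k. \<Sum>\<^sub>\<infinity>n. h (k, n)) = ellm (q\<^sup>2) * phim (q ^ 4)" .
  have "phim (q ^ 4) \<noteq> 0"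
    using phim_nonzero[OF square_lt_quarter[OF square_lt_quarter[OF assms]]]
    by (simp flip: power_mult)
  then show ?thesis using 1 2 by simp
qed

lemma ellm_at_0: "(ellm \<longlongrightarrow> 1/2) (at_right 0)"
proof -
  define l :: "int \<Rightarrow> real" where "l n = (if n = 0 then 1/2 else 0)" for n
  have l: "(l has_sum 1/2) UNIV"
    using has_sum_finite_neutralI[of "{0}" UNIV l "1/2"] by (auto simp: l_def)
  have "(ellm \<longlongrightarrow> infsum l UNIV) (at_right 0)"
    unfolding ellm_def
  proof (rule tendsto_infsum_at_0[where r = "1/4"])
    show "(\<lambda>n. alt n * kern q n) summable_on UNIV" if "0 < q" "q < 1/4" for q
      using that by (intro summable_kern) auto
    show "l summable_on UNIV" using l by (rule has_sum_imp_summable)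
    show "(\<lambda>n::int. 4 * (1/4::real) powi \<bar>n\<bar>) summable_on UNIV"
      by (intro summable_on_cmult_right summable_geometric_int) auto
    fix q :: real and n :: int assume q: "0 < q" "q < 1/4"
    show "\<bar>alt n * kern q n - l n\<bar> \<le> q * (4 * (1/4) powi \<bar>n\<bar>)"
    proof (cases "n = 0")
      case True
      then show ?thesis using q by (simp add: l_def kern_def alt_def)
    next
      case False
      have "\<bar>alt n * kern q n - l n\<bar> = kern q n"
        using False kern_nonneg[OF q(1), of n] by (simp add: l_def abs_mult abs_alt)
      also have "\<dots> \<le> q powi \<bar>n\<bar>" by (rule kern_le[OF q(1)])
      also have "\<dots> = q * q powi (\<bar>n\<bar> - 1)" using q by (simp add: power_int_diff)
      also have "\<dots> \<le> q * (1/4) powi (\<bar>n\<bar> - 1)"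
        using q False by (intro mult_left_mono power_int_mono) auto
      also have "\<dots> = q * (4 * (1/4) powi \<bar>n\<bar>)" by (simp add: power_int_diff)
      finally show ?thesis .
    qed
  qed simp
  then show ?thesis using infsumI[OF l] by simp
qed

text \<open>From \<open>ellm_mult_phi\<close>, \<open>appell_eq_ellm\<close> and
  \<open>phi_mult_phim\<close>, the quotient of the two sides is invariant under q -> q^2; the
  kernel at n = 0 makes its limit 1.\<close>

lemma ellm_eq:
  assumes "0 < q" "q < 1/4"
  shows "2 * ellm q = (phim q)\<^sup>2"
proof -
  define f where "f q = 2 * ellm q / (phim q)\<^sup>2" for q
  have "f q = 2 * (1/2) / 1\<^sup>2"
  proof (rule eq_limit_if_square_invariant[OF _ _ assms])
    fix q :: real assume q: "0 < q" "q < 1/4"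
    have q1: "q < 1" using q by simp
    have nz: "phim q \<noteq> 0" "phim (q\<^sup>2) \<noteq> 0"
      using phim_nonzero[OF q] phim_nonzero[OF square_lt_quarter[OF q]] by auto
    have "ellm q * (phim (q\<^sup>2))\<^sup>2 = (ellm q * phi q) * phim q"
      by (simp flip: phi_mult_phim[OF q(1) q1])
    also have "\<dots> = ellm (q\<^sup>2) * (phim q)\<^sup>2"
      by (simp add: ellm_mult_phi[OF q(1) q1] appell_eq_ellm[OF q] power2_eq_square)
    finally show "f q = f (q\<^sup>2)" using nz by (simp add: f_def field_simps)
  next
    show "(f \<longlongrightarrow> 2 * (1/2) / 1\<^sup>2) (at_right 0)"
      unfolding f_def by (intro tendsto_intros ellm_at_0 phim_at_0) simp
  qed
  then show ?thesis using phim_nonzero[OF assms] by (simp add: f_def)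
qed

text \<open>Dividing \<open>ell_mult_phim\<close> by \<open>ellm_mult_phi\<close> eliminates the
  Appell sum: \<open>ell\<close> is to \<open>ellm\<close> as \<open>phi^2\<close> is to
  \<open>phim^2\<close>.\<close>

theorem phi_square_eq:
  assumes "0 < q" "q < 1/4"
  shows "(phi q)\<^sup>2 = 2 * ell q"
proof -
  have q1: "q < 1" using assms by simp
  have "2 * ell q * (phim q)\<^sup>2 = 2 * (ell q * phim q) * phim q" by (simp add: power2_eq_square)
  also have "\<dots> = 2 * (ellm q * phi q) * phi q"
    by (simp add: ell_mult_phim[OF assms(1) q1] ellm_mult_phi[OF assms(1) q1])
  also have "\<dots> = (phi q)\<^sup>2 * (phim q)\<^sup>2"
    by (simp add: power2_eq_square flip: ellm_eq[OF assms, unfolded power2_eq_square])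
  finally show ?thesis using phim_nonzero[OF assms] by simp
qed

section \<open>An Appell-Lerch sum\<close>

text \<open>For 0 < q < 1 this is a smoothed step function, increasing from 0 at minus infinity to 1
  at plus infinity.\<close>

definition odd_kern :: "real \<Rightarrow> int \<Rightarrow> real" where
  "odd_kern q n = 1 / (1 + q powi (2 * n + 1))"

lemma odd_kern_bounds:
  assumes "0 < q"
  shows "0 \<le> odd_kern q n" "odd_kern q n \<le> 1"
    "odd_kern q n \<le> q powi (- (2 * n + 1))" "1 - odd_kern q n \<le> q powi (2 * n + 1)"
proof -
  define x where "x = q powi (2 * n + 1)"
  have x: "x > 0" using assms by (simp add: x_def)
  have o: "odd_kern q n = 1 / (1 + x)" by (simp add: odd_kern_def x_def)
  show "0 \<le> odd_kern q n" "odd_kern q n \<le> 1" using x by (auto simp: o)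
  show "odd_kern q n \<le> q powi (- (2 * n + 1))"
    unfolding power_int_minus x_def[symmetric] o using x by (simp add: field_simps)
  show "1 - odd_kern q n \<le> q powi (2 * n + 1)"
    unfolding x_def[symmetric] o using x by (simp add: field_simps)
qed

lemma odd_kern_mult:
  assumes "0 < q"
  shows "odd_kern q n * (1 + q powi (2 * n + 1)) = 1"
proof -
  have "1 + q powi (2 * n + 1) > 0" using assms by (intro add_pos_pos) auto
  then show ?thesis by (simp add: odd_kern_def)
qed

lemma tri2: "2 * tri n = n\<^sup>2 + n" "tri n * 2 = n\<^sup>2 + n"
  using tri_double[of n] by (simp_all add: power2_eq_square distrib_left mult.commute)

lemma summable_tri2:
  fixes q :: real
  assumes "0 < q" "q < 1"
  shows "(\<lambda>n. q powi (2 * tri n)) summable_on UNIV"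
  using summable_theta(3)[of "q\<^sup>2"] assms by (simp add: power_int_power power_less_one_iff)

definition appell_lerch :: "real \<Rightarrow> int \<Rightarrow> real" where
  "appell_lerch q j = (\<Sum>\<^sub>\<infinity>n. alt n * q powi (2 * tri n - (2 * n + 1) * j) * odd_kern q n)"

lemma summable_appell_lerch:
  assumes "0 < q" "q < 1"
  shows "(\<lambda>n. alt n * q powi (2 * tri n - (2 * n + 1) * j) * odd_kern q n) summable_on UNIV"
proof (rule summable_on_mult_bound)
  show "(\<lambda>n. q powi (2 * tri (n - j))) summable_on UNIV"
    using summable_tri2[OF assms]
    by (subst summable_on_reindex_bij_witness[of _ "\<lambda>n. n + j" "\<lambda>n. n - j" UNIV "\<lambda>n. q powi (2 * tri n)"]) auto
  fix n :: int
  have "2 * tri n - (2 * n + 1) * j = - j\<^sup>2 + 2 * tri (n - j)"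
    by (simp add: tri2 power2_eq_square algebra_simps)
  then have "q powi (2 * tri n - (2 * n + 1) * j) = q powi (- j\<^sup>2) * q powi (2 * tri (n - j))"
    using power_int_add[of q "- j\<^sup>2" "2 * tri (n - j)"] assms by simp
  moreover have "q powi (- j\<^sup>2) * q powi (2 * tri (n - j)) * odd_kern q n \<le> q powi (- j\<^sup>2) * q powi (2 * tri (n - j)) * 1"
    using odd_kern_bounds[OF assms(1), of n] assms by (intro mult_left_mono) auto
  ultimately show "\<bar>alt n * q powi (2 * tri n - (2 * n + 1) * j) * odd_kern q n\<bar>
      \<le> q powi (- j\<^sup>2) * q powi (2 * tri (n - j))"
    using odd_kern_bounds[OF assms(1), of n] assms by (simp add: abs_mult abs_alt)
qed

text \<open>As in \<open>appell_step\<close>, the sum of neighbours cancels the denominator, here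
  \<open>1 + q powi (2 * n + 1)\<close>, and the rest is antisymmetric under n -> 2j + 1 -
  n.\<close>

lemma appell_lerch_step:
  assumes "0 < q" "q < 1"
  shows "appell_lerch q j + appell_lerch q (j + 1) = 0"
proof -
  have "appell_lerch q j + appell_lerch q (j + 1) = (\<Sum>\<^sub>\<infinity>n. alt n * q powi (2 * tri n - (2 * n + 1) * j) * odd_kern q n
      + alt n * q powi (2 * tri n - (2 * n + 1) * (j + 1)) * odd_kern q n)"
    unfolding appell_lerch_def by (rule infsum_add[symmetric]) (rule summable_appell_lerch[OF assms])+
  also have "\<dots> = (\<Sum>\<^sub>\<infinity>n. alt n * q powi (2 * tri n - (2 * n + 1) * (j + 1)))"
  proof (intro infsum_cong)
    fix n
    define m where "m = 2 * tri n - (2 * n + 1) * (j + 1)"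
    have "2 * tri n - (2 * n + 1) * j = m + (2 * n + 1)" by (simp add: m_def algebra_simps)
    then have "q powi (2 * tri n - (2 * n + 1) * j) = q powi m * q powi (2 * n + 1)"
      using power_int_add[of q m "2 * n + 1"] assms by simp
    then have "alt n * q powi (2 * tri n - (2 * n + 1) * j) * odd_kern q n + alt n * q powi m * odd_kern q n
        = alt n * q powi m * (odd_kern q n * (1 + q powi (2 * n + 1)))"
      by (simp add: algebra_simps)
    then show "alt n * q powi (2 * tri n - (2 * n + 1) * j) * odd_kern q n
        + alt n * q powi (2 * tri n - (2 * n + 1) * (j + 1)) * odd_kern q n
        = alt n * q powi (2 * tri n - (2 * n + 1) * (j + 1))"
      by (simp add: odd_kern_mult[OF assms(1)] flip: m_def)
  qed
  also have "\<dots> = 0"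
    by (rule infsum_antisym[where c = "2 * j + 1"])
       (simp add: tri2 alt_def power2_eq_square algebra_simps)
  finally show ?thesis .
qed

text \<open>Shifting n by j absorbs \<open>q powi j^2\<close>, because 2 tri(n - j) = j^2 + 2 tri n
  - (2n + 1) j. The sign \<open>alt j\<close> from the shift cancels the one from the alternation of
  \<open>appell_lerch\<close> in j.\<close>

lemma appell_lerch_eq:
  assumes "0 < q" "q < 1"
  shows "q powi j\<^sup>2 * appell_lerch q 0 = (\<Sum>\<^sub>\<infinity>n. alt n * q powi (2 * tri n) * odd_kern q (n + j))"
proof -
  have "(\<Sum>\<^sub>\<infinity>n. alt n * q powi (2 * tri n) * odd_kern q (n + j))
      = (\<Sum>\<^sub>\<infinity>n. alt (n - j) * q powi (2 * tri (n - j)) * odd_kern q n)"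
    using infsum_shift[of "\<lambda>n. alt n * q powi (2 * tri n) * odd_kern q (n + j)" "- j"] by simp
  also have "\<dots> = (\<Sum>\<^sub>\<infinity>n. (alt j * q powi j\<^sup>2) * (alt n * q powi (2 * tri n - (2 * n + 1) * j) * odd_kern q n))"
  proof (intro infsum_cong)
    fix n
    have "2 * tri (n - j) = j\<^sup>2 + (2 * tri n - (2 * n + 1) * j)"
      by (simp add: tri2 power2_eq_square algebra_simps)
    then have "q powi (2 * tri (n - j)) = q powi j\<^sup>2 * q powi (2 * tri n - (2 * n + 1) * j)"
      using power_int_add[of q "j\<^sup>2" "2 * tri n - (2 * n + 1) * j"] assms by simp
    then show "alt (n - j) * q powi (2 * tri (n - j)) * odd_kern q n
        = (alt j * q powi j\<^sup>2) * (alt n * q powi (2 * tri n - (2 * n + 1) * j) * odd_kern q n)"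
      by (simp add: alt_diff)
  qed
  also have "\<dots> = alt j * q powi j\<^sup>2 * appell_lerch q j" by (simp add: infsum_cmult_right' appell_lerch_def)
  also have "appell_lerch q j = alt j * appell_lerch q 0"
    by (rule alternating_int_seq[where f = "appell_lerch q"]) (rule appell_lerch_step[OF assms])
  finally show ?thesis using alt_mult_self[of j] by (simp add: alt_def split: if_splits)
qed

text \<open>For j >= 0 both values are this close to 1, for j < 0 both are this close to 0. The
  decay in |j| is what makes the later interchange of sums legitimate.\<close>

lemma odd_kern_diff_bound:
  assumes "0 < q" "q < 1"
  shows "\<bar>odd_kern q (j + m) - odd_kern q (j - 1 - m)\<bar> \<le> q powi (2 * \<bar>j\<bar> - \<bar>2 * m + 1\<bar>)"
proof -
  note b1 = odd_kern_bounds[OF assms(1), of "j + m"]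
  note b2 = odd_kern_bounds[OF assms(1), of "j - 1 - m"]
  show ?thesis
  proof (cases "j \<ge> 0")
    case True
    have "q powi (2 * (j + m) + 1) \<le> q powi (2 * \<bar>j\<bar> - \<bar>2 * m + 1\<bar>)"
         "q powi (2 * (j - 1 - m) + 1) \<le> q powi (2 * \<bar>j\<bar> - \<bar>2 * m + 1\<bar>)"
      using True by (intro power_int_le_decreasing[OF assms]; simp)+
    then show ?thesis using b1(2,4) b2(2,4) by linarith
  next
    case False
    have "q powi (- (2 * (j + m) + 1)) \<le> q powi (2 * \<bar>j\<bar> - \<bar>2 * m + 1\<bar>)"
         "q powi (- (2 * (j - 1 - m) + 1)) \<le> q powi (2 * \<bar>j\<bar> - \<bar>2 * m + 1\<bar>)"
      using False by (intro power_int_le_decreasing[OF assms]; simp)+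
    then show ?thesis using b1(1,3) b2(1,3) by linarith
  qed
qed

lemma odd_kern_limits:
  assumes "0 < q" "q < 1"
  shows "(\<lambda>n. odd_kern q (int n)) \<longlonglongrightarrow> 1" "(\<lambda>n. odd_kern q (- int n)) \<longlonglongrightarrow> 0"
proof -
  have lim: "(\<lambda>n. q ^ n) \<longlonglongrightarrow> 0" using assms by (intro LIMSEQ_realpow_zero) auto
  have le: "q powi (2 * int n + 1) \<le> q ^ n" for n
    using power_int_le_decreasing[OF assms, of "int n" "2 * int n + 1"] by simp
  have "(\<lambda>n. 1 - odd_kern q (int n)) \<longlonglongrightarrow> 0"
  proof (rule tendsto_sandwich[OF _ _ tendsto_const lim])
    show "eventually (\<lambda>n. 0 \<le> 1 - odd_kern q (int n)) sequentially"
      using odd_kern_bounds[OF assms(1)] by (intro always_eventually) auto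
    show "eventually (\<lambda>n. 1 - odd_kern q (int n) \<le> q ^ n) sequentially"
      using order_trans[OF odd_kern_bounds(4)[OF assms(1)] le] by (intro always_eventually) auto
  qed
  from tendsto_diff[OF tendsto_const[of 1] this] show "(\<lambda>n. odd_kern q (int n)) \<longlonglongrightarrow> 1" by simp
  have le': "q powi (- (2 * - int n + 1)) \<le> 1 / q * q ^ n" for n
    using power_int_le_decreasing[OF assms, of "int n - 1" "- (2 * - int n + 1)"] assms
    by (simp add: power_int_diff)
  have lim': "(\<lambda>n. 1 / q * q ^ n) \<longlonglongrightarrow> 0" using tendsto_mult_left[OF lim, of "1 / q"] by simp
  show "(\<lambda>n. odd_kern q (- int n)) \<longlonglongrightarrow> 0"
  proof (rule tendsto_sandwich[OF _ _ tendsto_const lim'])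
    show "eventually (\<lambda>n. 0 \<le> odd_kern q (- int n)) sequentially"
      using odd_kern_bounds[OF assms(1)] by (intro always_eventually) auto
    show "eventually (\<lambda>n. odd_kern q (- int n) \<le> 1 / q * q ^ n) sequentially"
      using order_trans[OF odd_kern_bounds(3)[OF assms(1)] le'] by (intro always_eventually) auto
  qed
qed

lemma odd_kern_mono:
  assumes "0 < q" "q < 1"
  shows "odd_kern q n \<le> odd_kern q (n + 1)"
proof -
  have "q powi (2 * (n + 1) + 1) \<le> q powi (2 * n + 1)"
    by (rule power_int_le_decreasing[OF assms]) simp
  then show ?thesis
    unfolding odd_kern_def using assms by (intro divide_left_mono mult_pos_pos add_pos_pos) auto
qed

text \<open>The total rise of the step function. Monotonicity makes the telescoping terms
  nonnegative, which upgrades the ordered sums on the two half-lines to unconditional ones.\<close>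

lemma has_sum_odd_kern_step:
  assumes "0 < q" "q < 1"
  shows "((\<lambda>j. odd_kern q (j + 1) - odd_kern q j) has_sum 1) UNIV"
proof -
  note mono = odd_kern_mono[OF assms]
  note lim = odd_kern_limits[OF assms]
  have "((\<lambda>n. odd_kern q (int (Suc n)) - odd_kern q (int n)) has_sum (1 - odd_kern q (int 0))) UNIV"
    using telescope_sums[OF lim(1)] mono[of "int _"]
    by (intro sums_nonneg_imp_has_sum) (auto simp: add.commute)
  then have 1: "((\<lambda>j. odd_kern q (j + 1) - odd_kern q j) has_sum (1 - odd_kern q 0)) {0..}"
    by (subst has_sum_reindex_bij_witness[of _ int nat UNIV
          "\<lambda>n. odd_kern q (int (Suc n)) - odd_kern q (int n)"]) (auto simp: add.commute)
  have "((\<lambda>n. odd_kern q (- int n) - odd_kern q (- int (Suc n))) has_sum (odd_kern q (- int 0) - 0)) UNIV"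
    using telescope_sums'[OF lim(2)] mono[of "- int (Suc _)"]
    by (intro sums_nonneg_imp_has_sum) (auto simp: add.commute)
  then have 2: "((\<lambda>j. odd_kern q (j + 1) - odd_kern q j) has_sum odd_kern q 0) {..<0}"
    by (subst has_sum_reindex_bij_witness[of _ "\<lambda>n. - 1 - int n" "\<lambda>j. nat (- 1 - j)" UNIV
          "\<lambda>n. odd_kern q (- int n) - odd_kern q (- int (Suc n))"]) (auto simp: add.commute)
  have "((\<lambda>j. odd_kern q (j + 1) - odd_kern q j) has_sum (1 - odd_kern q 0 + odd_kern q 0)) ({0..} \<union> {..<0})"
    by (rule has_sum_Un_disjoint[OF 1 2]) auto
  moreover have "{0..} \<union> {..<0} = (UNIV :: int set)" by auto
  ultimately show ?thesis by simp
qed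

lemma has_sum_odd_kern_diff:
  assumes "0 < q" "q < 1"
  shows "((\<lambda>j. odd_kern q (j + m) - odd_kern q j) has_sum of_int m) UNIV"
proof -
  have step: "((\<lambda>j. odd_kern q (j + (k + 1)) - odd_kern q (j + k)) has_sum 1) UNIV" for k
    using has_sum_odd_kern_step[OF assms]
    by (subst has_sum_reindex_bij_witness[of _ "\<lambda>j. j - k" "\<lambda>j. j + k" UNIV
          "\<lambda>j. odd_kern q (j + 1) - odd_kern q j"]) (auto simp: ac_simps)
  show ?thesis
  proof (induction m rule: int_induct[where k = 0])
    case (step1 i)
    show ?case using has_sum_add[OF step1(2) step[of i]] by simp
  next
    case (step2 i)
    show ?case
      using has_sum_add[OF step2(2) has_sum_uminusI[OF step[of "i - 1"]]] by simp
  qed simp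
qed

text \<open>Completing the square moves the dependence of \<open>q powi j\<^sup>2 * appell_lerch q 0\<close> on \<open>j\<close> into the
  factor \<open>odd_kern q (n + j)\<close>, and the sum of that factor over \<open>j\<close> telescopes.\<close>

theorem phi_mult_appell_lerch:
  assumes "0 < q" "q < 1/4"
  shows "2 * phi q * appell_lerch q 0 = cube2 (q\<^sup>2)"
proof -
  have q1: "q < 1" using assms by simp
  \<comment> \<open>The terms at n and -1 - n are paired, because \<open>odd_kern (n + j)\<close>
    alone is not summable over j while the difference is. Each row then counts the sum of
    \<open>appell_lerch_eq\<close> twice.\<close>
  define T where "T = (\<lambda>(j, n). alt n * q powi (2 * tri n) * (odd_kern q (j + n) - odd_kern q (j - 1 - n)))"
  have "(\<lambda>j::int. (q\<^sup>2) powi \<bar>j\<bar>) summable_on UNIV"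
    using assms q1 by (intro summable_geometric_int) (auto simp: power_less_one_iff)
  then have g2: "(\<lambda>j::int. q powi (2 * \<bar>j\<bar>)) summable_on UNIV" by (simp add: power_int_power)
  have "T summable_on UNIV \<times> UNIV"
  proof (rule summable_on_product_bound[OF g2 summable_geometric_int[OF assms(1) q1]])
    fix j n :: int
    \<comment> \<open>The quadratic exponent outweighs the growth allowed by
      \<open>odd_kern_diff_bound\<close>; equality at n = -2 fixes the constant 3.\<close>
    have "\<bar>n\<bar> - 3 \<le> 2 * tri n - \<bar>2 * n + 1\<bar>"
    proof (cases "n \<ge> 0")
      case True
      have "0 \<le> (n - 1)\<^sup>2 + 1" by simp
      then have "0 \<le> n\<^sup>2 - 2 * n + 2" by (simp add: power2_diff)
      then show ?thesis using True by (simp add: tri2)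
    next
      case False
      have "0 \<le> (n + 2)\<^sup>2" by simp
      then have "0 \<le> n\<^sup>2 + 4 * n + 4" by (simp add: power2_sum)
      then show ?thesis using False by (simp add: tri2)
    qed
    then have e: "q powi (2 * tri n + (2 * \<bar>j\<bar> - \<bar>2 * n + 1\<bar>)) \<le> q powi (2 * \<bar>j\<bar> + \<bar>n\<bar> - 3)"
      by (intro power_int_le_decreasing[OF assms(1) q1]) simp
    have "\<bar>T (j, n)\<bar> = q powi (2 * tri n) * \<bar>odd_kern q (j + n) - odd_kern q (j - 1 - n)\<bar>"
      using assms by (simp add: T_def abs_mult abs_alt)
    also have "\<dots> \<le> q powi (2 * tri n) * q powi (2 * \<bar>j\<bar> - \<bar>2 * n + 1\<bar>)"
      using odd_kern_diff_bound[OF assms(1) q1] assms by (intro mult_left_mono) auto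
    also have "\<dots> \<le> q powi (2 * \<bar>j\<bar> + \<bar>n\<bar> - 3)"
      using e power_int_add[of q "2 * tri n" "2 * \<bar>j\<bar> - \<bar>2 * n + 1\<bar>"] assms by simp
    also have "\<dots> = 1 / q ^ 3 * (q powi (2 * \<bar>j\<bar>) * q powi \<bar>n\<bar>)"
      using assms by (simp add: power_int_add power_int_diff)
    finally show "\<bar>T (j, n)\<bar> \<le> 1 / q ^ 3 * (q powi (2 * \<bar>j\<bar>) * q powi \<bar>n\<bar>)" .
  qed
  then have swap: "(\<Sum>\<^sub>\<infinity>j. \<Sum>\<^sub>\<infinity>n. T (j, n)) = (\<Sum>\<^sub>\<infinity>n. \<Sum>\<^sub>\<infinity>j. T (j, n))"
    by (intro infsum_swap_banach) (simp add: case_prod_unfold)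
  have row: "(\<Sum>\<^sub>\<infinity>n. T (j, n)) = 2 * (q powi j\<^sup>2 * appell_lerch q 0)" for j
  proof -
    define f where "f = (\<lambda>n. alt n * q powi (2 * tri n) * odd_kern q (n + j))"
    have f: "f summable_on UNIV"
    proof (rule summable_on_bound[OF summable_tri2[OF assms(1) q1]])
      fix n
      have "q powi (2 * tri n) * odd_kern q (n + j) \<le> q powi (2 * tri n) * 1"
        using odd_kern_bounds[OF assms(1)] assms by (intro mult_left_mono) auto
      then show "\<bar>f n\<bar> \<le> q powi (2 * tri n)"
        using odd_kern_bounds[OF assms(1)] assms by (simp add: f_def abs_mult abs_alt)
    qed
    have f': "(\<lambda>n. f (- 1 - n)) summable_on UNIV"
      using f by (subst summable_on_reindex_bij_witness[of _ "\<lambda>n. - 1 - n" "\<lambda>n. - 1 - n" UNIV f]) auto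
    have "(\<Sum>\<^sub>\<infinity>n. T (j, n)) = (\<Sum>\<^sub>\<infinity>n. f n + f (- 1 - n))"
      by (intro infsum_cong) (simp add: T_def f_def tri_reflect alt_def algebra_simps)
    also have "\<dots> = infsum f UNIV + (\<Sum>\<^sub>\<infinity>n. f (- 1 - n))" by (rule infsum_add[OF f f'])
    also have "(\<Sum>\<^sub>\<infinity>n. f (- 1 - n)) = infsum f UNIV" by (rule infsum_reflect[symmetric])
    finally show ?thesis by (simp add: appell_lerch_eq[OF assms(1) q1] f_def)
  qed
  have column: "(\<Sum>\<^sub>\<infinity>j. T (j, n)) = alt n * real_of_int (2 * n + 1) * (q\<^sup>2) powi tri n" for n
  proof -
    have "(\<Sum>\<^sub>\<infinity>j. odd_kern q (j + n) - odd_kern q (j - 1 - n))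
        = (\<Sum>\<^sub>\<infinity>j. odd_kern q (j + (2 * n + 1)) - odd_kern q j)"
      by (rule infsum_reindex_bij_witness[of _ "\<lambda>j. j + 1 + n" "\<lambda>j. j - 1 - n"]) (auto simp: ac_simps)
    also have "\<dots> = of_int (2 * n + 1)"
      by (rule infsumI[OF has_sum_odd_kern_diff[OF assms(1) q1]])
    finally show ?thesis by (simp add: T_def infsum_cmult_right' power_int_power)
  qed
  have "2 * phi q * appell_lerch q 0 = (\<Sum>\<^sub>\<infinity>j. \<Sum>\<^sub>\<infinity>n. T (j, n))"
    unfolding row by (simp add: infsum_cmult_right' infsum_cmult_left' phi_def)
  also have "\<dots> = cube2 (q\<^sup>2)" unfolding swap column cube2_def ..
  finally show ?thesis .
qed

section \<open>The class number formula\<close>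

text \<open>The exponent is that of \<open>appell\<close> at the half-integral parameter a +
  1/2.\<close>

definition xi :: "real \<Rightarrow> int \<Rightarrow> real" where
  "xi q a = (\<Sum>\<^sub>\<infinity>e. alt e * q powi (e\<^sup>2 - e * (2 * a + 1)) * kern q e)"

lemma xi_reflect: "xi q (- 1 - a) = xi q a"
  unfolding xi_def
  by (subst infsum_reflect[where c = 0]) (simp add: alt_minus kern_minus algebra_simps)

text \<open>The kernel cancels as in \<open>appell_step\<close>, but now the remaining exponent is
  centred at the integer a + 1, so completing the square gives \<open>phim\<close> instead of
  0.\<close>

lemma xi_step:
  assumes "0 < q" "q < 1"
  shows "xi q a + xi q (a + 1) = alt (a + 1) * q powi (- (a + 1)\<^sup>2) * phim q"
proof -
  have "xi q a + xi q (a + 1) = (\<Sum>\<^sub>\<infinity>e. alt e * q powi (e\<^sup>2 - e * (2 * a + 1)) * kern q e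
      + alt e * q powi (e\<^sup>2 - e * (2 * (a + 1) + 1)) * kern q e)"
    unfolding xi_def by (rule infsum_add[symmetric]) (rule summable_appell[OF assms])+
  also have "\<dots> = (\<Sum>\<^sub>\<infinity>e. alt e * q powi (e\<^sup>2 - 2 * e * (a + 1)))"
  proof (intro infsum_cong)
    fix e
    show "alt e * q powi (e\<^sup>2 - e * (2 * a + 1)) * kern q e
      + alt e * q powi (e\<^sup>2 - e * (2 * (a + 1) + 1)) * kern q e = alt e * q powi (e\<^sup>2 - 2 * e * (a + 1))"
      using arg_cong[OF powi_kern_telescope[OF assms(1), of "e\<^sup>2 - 2 * e * (a + 1)" e], of "\<lambda>x. alt e * x"]
      by (simp add: algebra_simps)
  qed
  also have "\<dots> = (\<Sum>\<^sub>\<infinity>e. alt (e + (a + 1)) * q powi ((e + (a + 1))\<^sup>2 - 2 * (e + (a + 1)) * (a + 1)))"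
    by (rule infsum_shift)
  also have "\<dots> = (\<Sum>\<^sub>\<infinity>e. (alt (a + 1) * q powi (- (a + 1)\<^sup>2)) * (alt e * q powi e\<^sup>2))"
  proof (intro infsum_cong)
    fix e
    have "(e + (a + 1))\<^sup>2 - 2 * (e + (a + 1)) * (a + 1) = - (a + 1)\<^sup>2 + e\<^sup>2"
      by (simp add: power2_eq_square algebra_simps)
    then have "q powi ((e + (a + 1))\<^sup>2 - 2 * (e + (a + 1)) * (a + 1)) = q powi (- (a + 1)\<^sup>2) * q powi e\<^sup>2"
      using power_int_add[of q "- (a + 1)\<^sup>2" "e\<^sup>2"] assms by simp
    then show "alt (e + (a + 1)) * q powi ((e + (a + 1))\<^sup>2 - 2 * (e + (a + 1)) * (a + 1))
        = (alt (a + 1) * q powi (- (a + 1)\<^sup>2)) * (alt e * q powi e\<^sup>2)"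
      by (simp add: alt_add[of e "a + 1"])
  qed
  finally show ?thesis by (simp add: infsum_cmult_right' phim_def)
qed

text \<open>Enlarging the window by one adds b = a + 1 and b = -(a + 1), and \<open>xi_step\<close>
  expresses exactly these two terms times \<open>phim q\<close>.\<close>

lemma phim_mult_window_sum:
  assumes "0 < q" "q < 1"
  shows "phim q * (\<Sum>b=- int a..int a. q powi (- b\<^sup>2)) = 2 * alt (int a) * xi q (int a)"
proof (induction a)
  case 0
  \<comment> \<open>By reflection \<open>xi q (-1) = xi q 0\<close>, so the step from -1 to 0 reads
    \<open>2 * xi q 0 = phim q\<close>.\<close>
  show ?case using xi_step[OF assms, of "- 1"] xi_reflect[of q 0] by (simp add: alt_def)
next
  case (Suc a)
  have "{- int (Suc a)..int (Suc a)} = insert (- int (Suc a)) (insert (int (Suc a)) {- int a..int a})"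
    by auto
  then have "(\<Sum>b=- int (Suc a)..int (Suc a). q powi (- b\<^sup>2))
      = 2 * q powi (- (int a + 1)\<^sup>2) + (\<Sum>b=- int a..int a. q powi (- b\<^sup>2))"
    by (simp add: add.commute) (simp add: power2_eq_square algebra_simps)
  then have "phim q * (\<Sum>b=- int (Suc a)..int (Suc a). q powi (- b\<^sup>2))
      = 2 * (q powi (- (int a + 1)\<^sup>2) * phim q) + 2 * alt (int a) * xi q (int a)"
    using Suc by (simp add: distrib_left)
  also have "q powi (- (int a + 1)\<^sup>2) * phim q = alt (int a + 1) * (xi q (int a) + xi q (int a + 1))"
    using xi_step[OF assms, of "int a"] alt_mult_self[of "int a + 1"] by (simp flip: mult.assoc)
  also have "2 * (alt (int a + 1) * (xi q (int a) + xi q (int a + 1))) + 2 * alt (int a) * xi q (int a)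
      = 2 * alt (int (Suc a)) * xi q (int (Suc a))"
    by (simp add: alt_def add.commute)
  finally show ?case .
qed

text \<open>The part of the class number series with fixed a: the fraction is the sum over all
  integers c of \<open>q powi ((2 * a + 1) * |c|)\<close>.\<close>

definition form_term :: "real \<Rightarrow> int \<Rightarrow> real" where
  "form_term q a = q powi (2 * tri a) * ((1 + q powi (2 * a + 1)) / (1 - q powi (2 * a + 1)))
     * (\<Sum>b=-a..a. q powi (- b\<^sup>2))"

section \<open>A double series evaluated by partial fractions\<close>

lemma abs_one_minus_odd_powi:
  fixes q :: real
  assumes "0 < q" "q < 1/4"
  shows "\<bar>1 - q powi (2 * i + 1)\<bar> \<ge> 1/2"
proof (cases "i \<ge> 0")
  case True
  then have "q powi (2 * i + 1) \<le> q powi 1"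
    using assms by (intro power_int_le_decreasing) auto
  then show ?thesis using assms by simp
next
  case False
  then have "q powi (- 1) \<le> q powi (2 * i + 1)"
    using assms by (intro power_int_le_decreasing) auto
  moreover have "q powi (- 1) > 4" using assms by (simp add: power_int_minus field_simps)
  ultimately show ?thesis by simp
qed

lemma odd_powi_neq_1:
  fixes q :: real
  assumes "0 < q" "q < 1/4"
  shows "q powi (2 * i + 1) \<noteq> 1"
  using abs_one_minus_odd_powi[OF assms, of i] by auto

text \<open>Applied with x = q^e and y = q^(2k+1), this separates the kernel from the denominator
  \<open>1 - q powi (2 * (k + e) + 1)\<close>.\<close>

lemma partial_fraction_kern:
  fixes x y :: real
  assumes "1 + x\<^sup>2 \<noteq> 0" "1 - y * x\<^sup>2 \<noteq> 0"
  shows "(1 + y) * (x / (1 + x\<^sup>2) / (1 - y * x\<^sup>2)) = x / (1 + x\<^sup>2) + y * (x / (1 - y * x\<^sup>2))"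
proof -
  define a where "a = 1 + x\<^sup>2"
  define b where "b = 1 - y * x\<^sup>2"
  have "x / a + y * (x / b) = (x * b + y * x * a) / (a * b)"
    using assms by (simp add: add_frac_eq flip: a_def b_def)
  also have "x * b + y * x * a = (1 + y) * x" by (simp add: a_def b_def algebra_simps)
  finally show ?thesis by (simp flip: a_def b_def)
qed

text \<open>With the same x and y, the inversion x -> 1/(yx) is the reflection e -> -(2k + 1) - e of
  the summation index.\<close>

lemma inversion_antisym:
  fixes x y :: real
  assumes "x > 0" "y > 0" "1 - y * x\<^sup>2 \<noteq> 0"
  shows "y * (1 / (y * x) / (1 - y * (1 / (y * x))\<^sup>2)) = - (y * (x / (1 - y * x\<^sup>2)))"
proof -
  define d where "d = 1 - y * x\<^sup>2"
  have "1 - y * (1 / (y * x))\<^sup>2 = - d / (y * x\<^sup>2)"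
    using assms by (simp add: d_def power2_eq_square divide_simps)
  then have "y * (1 / (y * x) / (1 - y * (1 / (y * x))\<^sup>2)) = y * (1 / (y * x) / (- d / (y * x\<^sup>2)))"
    by simp
  also have "\<dots> = - (y * (x / d))"
    using assms by (simp add: power2_eq_square flip: d_def)
  finally show ?thesis by (simp add: d_def)
qed

context
  fixes q :: real
  assumes q: "0 < q" "q < 1/4"
begin

private lemma q1: "q < 1" using q by simp

text \<open>Rows of constant k lead to \<open>ell\<close> and \<open>appell_lerch\<close>; diagonals
  of constant a = k + e lead to \<open>xi\<close>. Comparing the two orders links the class number
  series with known functions.\<close>

definition double_term :: "int \<times> int \<Rightarrow> real" where
  "double_term = (\<lambda>(k, e). alt k * q powi (2 * tri k) * kern q e / (1 - q powi (2 * (k + e) + 1)))"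

lemma summable_double_term: "double_term summable_on UNIV \<times> UNIV"
proof (rule summable_on_product_bound[OF summable_tri2[OF q(1) q1] summable_kern(1)[OF q(1) q1]])
  fix k e :: int
  have n: "0 \<le> q powi (2 * tri k) * kern q e" using q kern_nonneg by simp
  have "\<bar>double_term (k, e)\<bar> = q powi (2 * tri k) * kern q e / \<bar>1 - q powi (2 * (k + e) + 1)\<bar>"
    using q kern_nonneg[OF q(1)] by (simp add: double_term_def abs_mult abs_alt)
  also have "\<dots> \<le> q powi (2 * tri k) * kern q e / (1/2)"
    using n abs_one_minus_odd_powi[OF q, of "k + e"] by (intro divide_left_mono mult_pos_pos) auto
  finally show "\<bar>double_term (k, e)\<bar> \<le> 2 * (q powi (2 * tri k) * kern q e)" by simp
qed

text \<open>By partial fractions, \<open>1 + y\<close> times the row splits into the kernel series,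
  with sum \<open>ell q\<close>, and a series that is antisymmetric under e -> -(2k + 1) - e and
  sums to 0. Dividing by \<open>1 + y\<close> produces \<open>odd_kern q k\<close>.\<close>

lemma sum_double_term_row:
  "(\<Sum>\<^sub>\<infinity>e. double_term (k, e)) = alt k * q powi (2 * tri k) * (ell q * odd_kern q k)"
proof -
  define y where "y = q powi (2 * k + 1)"
  define X where "X e = q powi e" for e
  define D where "D e = 1 - q powi (2 * (k + e) + 1)" for e
  have y: "y > 0" and X: "X e > 0" for e using q by (auto simp: y_def X_def)
  have D: "D e = 1 - y * (X e)\<^sup>2" for e
  proof -
    have "q powi (2 * (k + e) + 1) = q powi (2 * k + 1) * (q powi e * q powi e)"
      using q by (simp flip: power_int_add) (simp add: algebra_simps)
    then show ?thesis by (simp add: D_def y_def X_def power2_eq_square)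
  qed
  have D0: "D e \<noteq> 0" for e using odd_powi_neq_1[OF q, of "k + e"] by (simp add: D_def)
  have kern: "kern q e = X e / (1 + (X e)\<^sup>2)" for e
  proof -
    have "X e + inverse (X e) = (1 + (X e)\<^sup>2) / X e"
      using X[of e] by (simp add: field_simps power2_eq_square)
    then show ?thesis by (simp add: kern_def power_int_minus flip: X_def)
  qed
  define f where "f = (\<lambda>e. kern q e / D e)"
  have f: "f summable_on UNIV"
  proof (rule summable_on_mult_bound[OF summable_kern(1)[OF q(1) q1]])
    fix e
    have "\<bar>f e\<bar> = kern q e / \<bar>D e\<bar>" using kern_nonneg[OF q(1)] by (simp add: f_def)
    also have "\<dots> \<le> kern q e / (1/2)"
      using abs_one_minus_odd_powi[OF q, of "k + e"] D0[of e] kern_nonneg[OF q(1), of e]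
      by (intro divide_left_mono mult_pos_pos) (auto simp: D_def)
    finally show "\<bar>f e\<bar> \<le> 2 * kern q e" by simp
  qed
  have pf: "(1 + y) * f e = kern q e + y * (X e / D e)" for e
  proof -
    have "1 + (X e)\<^sup>2 \<noteq> 0" by (simp add: add_nonneg_eq_0_iff)
    then show ?thesis
      using D0[of e] unfolding f_def kern D by (rule partial_fraction_kern)
  qed
  have g: "(\<lambda>e. y * (X e / D e)) summable_on UNIV"
  proof -
    have "(\<lambda>e. (1 + y) * f e + - kern q e) summable_on UNIV"
      by (intro summable_on_add summable_on_cmult_right f iffD2[OF summable_on_uminus] summable_kern q q1)
    then show ?thesis by (simp add: pf)
  qed
  have "(1 + y) * infsum f UNIV = (\<Sum>\<^sub>\<infinity>e. (1 + y) * f e)" by (simp add: infsum_cmult_right')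
  also have "\<dots> = ell q + (\<Sum>\<^sub>\<infinity>e. y * (X e / D e))"
    unfolding pf ell_def by (rule infsum_add[OF summable_kern(1)[OF q(1) q1] g])
  also have "(\<Sum>\<^sub>\<infinity>e. y * (X e / D e)) = 0"
  proof (rule infsum_antisym[where c = "- (2 * k + 1)"])
    fix e
    have "- (2 * k + 1) - e = - ((2 * k + 1) + e)" by simp
    then have "X (- (2 * k + 1) - e) = 1 / q powi ((2 * k + 1) + e)"
      unfolding X_def by (simp only: power_int_minus_divide)
    also have "q powi ((2 * k + 1) + e) = y * X e"
      unfolding X_def y_def by (rule power_int_add) (use q in simp)
    finally have "X (- (2 * k + 1) - e) = 1 / (y * X e)" .
    then show "y * (X (- (2 * k + 1) - e) / D (- (2 * k + 1) - e)) = - (y * (X e / D e))"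
      using D0[of e] inversion_antisym[OF X[of e] y] unfolding D by simp
  qed
  finally have "infsum f UNIV = ell q * odd_kern q k"
    unfolding odd_kern_def y_def[symmetric] using y by (simp add: field_simps)
  moreover have "(\<Sum>\<^sub>\<infinity>e. double_term (k, e)) = (\<Sum>\<^sub>\<infinity>e. (alt k * q powi (2 * tri k)) * f e)"
    by (simp add: double_term_def f_def D_def)
  ultimately show ?thesis by (simp add: infsum_cmult_right')
qed

lemma sum_double_term: "infsum double_term UNIV = ell q * appell_lerch q 0"
proof -
  have "infsum double_term UNIV = (\<Sum>\<^sub>\<infinity>k. \<Sum>\<^sub>\<infinity>e. double_term (k, e))"
    using infsum_Sigma_banach[OF summable_double_term] by simp
  also have "\<dots> = (\<Sum>\<^sub>\<infinity>k. ell q * (alt k * q powi (2 * tri k) * odd_kern q k))"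
    unfolding sum_double_term_row by (simp add: mult_ac)
  finally show ?thesis by (simp add: infsum_cmult_right' appell_lerch_def)
qed

definition xi_term :: "int \<Rightarrow> real" where
  "xi_term a = alt a * q powi (2 * tri a) * xi q a / (1 - q powi (2 * a + 1))"

text \<open>Along the diagonal k = a - e the exponent 2 tri(a - e) equals 2 tri a + e^2 - e(2a + 1),
  so the inner sum over e is \<open>xi q a\<close>.\<close>

lemma has_sum_xi_term: "(xi_term has_sum (ell q * appell_lerch q 0)) UNIV"
proof -
  have "(double_term has_sum (ell q * appell_lerch q 0)) (UNIV \<times> UNIV)"
    using summable_double_term sum_double_term by (simp add: has_sum_iff)
  moreover have "((\<lambda>(a, e). double_term (a - e, e)) has_sum (ell q * appell_lerch q 0)) (UNIV \<times> UNIV) \<longleftrightarrow>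
      (double_term has_sum (ell q * appell_lerch q 0)) (UNIV \<times> UNIV)"
    by (rule has_sum_reindex_bij_witness[of _ "\<lambda>(k, e). (k + e, e)" "\<lambda>(a, e). (a - e, e)"]) auto
  ultimately have h: "((\<lambda>(a, e). double_term (a - e, e)) has_sum (ell q * appell_lerch q 0)) (UNIV \<times> UNIV)"
    by simp
  show ?thesis
  proof (rule has_sum_Sigma'[OF h])
    fix a :: int
    have "double_term (a - e, e) = alt a * q powi (2 * tri a) / (1 - q powi (2 * a + 1))
        * (alt e * q powi (e\<^sup>2 - e * (2 * a + 1)) * kern q e)" for e
    proof -
      have "2 * tri (a - e) = 2 * tri a + (e\<^sup>2 - e * (2 * a + 1))"
        by (simp add: tri2 power2_eq_square algebra_simps)
      then have "q powi (2 * tri (a - e)) = q powi (2 * tri a) * q powi (e\<^sup>2 - e * (2 * a + 1))"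
        using power_int_add[of q "2 * tri a" "e\<^sup>2 - e * (2 * a + 1)"] q by simp
      then show ?thesis by (simp add: double_term_def alt_diff)
    qed
    then show "((\<lambda>e. case (a, e) of (a, e) \<Rightarrow> double_term (a - e, e)) has_sum xi_term a) UNIV"
      using has_sum_cmult_right[OF has_sum_infsum[OF summable_appell[OF q(1) q1, of "2 * a + 1"]],
          of "alt a * q powi (2 * tri a) / (1 - q powi (2 * a + 1))"]
      by (simp add: xi_term_def xi_def)
  qed
qed

text \<open>The window sum becomes \<open>xi\<close>, and (1 + y)/(1 - y) = 1/(1 - y) - 1/(1 - 1/y).
  The reflection a -> -1 - a replaces y by 1/y, keeps \<open>xi\<close> and \<open>tri\<close>, and
  flips the sign \<open>alt a\<close>.\<close>

lemma phim_mult_form_term: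
  assumes "a \<ge> 0"
  shows "phim q * form_term q a = 2 * (xi_term a + xi_term (- 1 - a))"
proof -
  define y where "y = q powi (2 * a + 1)"
  have y: "y > 0" "y \<noteq> 1" using q odd_powi_neq_1[OF q] by (auto simp: y_def)
  have e: "2 * (- 1 - a) + 1 = - (2 * a + 1)" by simp
  have y': "q powi (2 * (- 1 - a) + 1) = 1 / y"
    unfolding e power_int_minus y_def by (simp add: divide_inverse)
  have w: "phim q * (\<Sum>b=-a..a. q powi (- b\<^sup>2)) = 2 * alt a * xi q a"
    using phim_mult_window_sum[OF q(1) q1, of "nat a"] assms by simp
  have "phim q * form_term q a
      = q powi (2 * tri a) * ((1 + y) / (1 - y)) * (phim q * (\<Sum>b=-a..a. q powi (- b\<^sup>2)))"
    by (simp add: form_term_def y_def)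
  also have "\<dots> = 2 * (alt a * q powi (2 * tri a) * xi q a) * ((1 + y) / (1 - y))"
    unfolding w by simp
  also have "(1 + y) / (1 - y) = 1 / (1 - y) - 1 / (1 - 1 / y)"
  proof -
    have "1 - 1 / y = (y - 1) / y" using y by (simp add: field_simps)
    then have "1 / (1 - 1 / y) = y / (y - 1)" by simp
    also have "\<dots> = - (y / (1 - y))" using minus_divide_right[of y "1 - y"] by simp
    finally have "1 / (1 - 1 / y) = - (y / (1 - y))" .
    then show ?thesis by (simp add: add_divide_distrib)
  qed
  also have "2 * (alt a * q powi (2 * tri a) * xi q a) * (1 / (1 - y) - 1 / (1 - 1 / y))
      = 2 * (xi_term a + xi_term (- 1 - a))"
  proof -
    have "alt (- 1 - a) = - alt a" by (simp add: alt_def)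
    then have "xi_term (- 1 - a) = - (alt a * q powi (2 * tri a) * xi q a) * (1 / (1 - 1 / y))"
      unfolding xi_term_def y' xi_reflect tri_reflect by simp
    moreover have "xi_term a = alt a * q powi (2 * tri a) * xi q a * (1 / (1 - y))"
      by (simp add: xi_term_def y_def)
    moreover have "2 * c * (p - r) = 2 * (c * p + - c * r)" for c p r :: real
      by (simp add: algebra_simps)
    ultimately show ?thesis by simp
  qed
  finally show ?thesis .
qed

text \<open>Folding the sum over all integers a onto a >= 0 gives \<open>2 / phim q\<close> times
  \<open>ell q * appell_lerch q 0\<close>. Then \<open>phi_square_eq\<close>,
  \<open>phi_mult_appell_lerch\<close>, \<open>cube2_eq\<close> at q^2 and
  \<open>phi_mult_phim\<close> remove the auxiliary functions.\<close>

lemma has_sum_form_term: "(form_term q has_sum (phi q)\<^sup>2 * psi2 (q\<^sup>2) / 2) {0..}"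
proof -
  note s = has_sum_imp_summable[OF has_sum_xi_term]
  have s1: "xi_term summable_on {0..}" and s2: "xi_term summable_on {..<0}"
    by (rule summable_on_subset[OF s], simp)+
  have h2: "((\<lambda>a. xi_term (- 1 - a)) has_sum infsum xi_term {..<0}) {0..}"
    using has_sum_infsum[OF s2]
    by (subst has_sum_reindex_bij_witness[of _ "\<lambda>a. - 1 - a" "\<lambda>a. - 1 - a" "{..<0}" xi_term]) auto
  have U: "{0..} \<union> {..<0} = (UNIV :: int set)" by auto
  have "infsum xi_term {0..} + infsum xi_term {..<0} = ell q * appell_lerch q 0"
    using infsum_Un_disjoint[OF s1 s2] infsumI[OF has_sum_xi_term] unfolding U by force
  then have "((\<lambda>a. xi_term a + xi_term (- 1 - a)) has_sum (ell q * appell_lerch q 0)) {0..}"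
    using has_sum_add[OF has_sum_infsum[OF s1] h2] by simp
  from has_sum_cmult_right[OF this, of "2 / phim q"]
  have "((\<lambda>a. 2 / phim q * (xi_term a + xi_term (- 1 - a))) has_sum (2 / phim q * (ell q * appell_lerch q 0))) {0..}" .
  also have "?this \<longleftrightarrow> (form_term q has_sum (2 / phim q * (ell q * appell_lerch q 0))) {0..}"
    using phim_mult_form_term phim_nonzero[OF q]
    by (intro has_sum_cong) (auto simp: field_simps)
  finally have G: "(form_term q has_sum (2 / phim q * (ell q * appell_lerch q 0))) {0..}" .
  have "2 * (2 * ell q * appell_lerch q 0) = phi q * (2 * phi q * appell_lerch q 0)"
    by (simp add: power2_eq_square flip: phi_square_eq[OF q])
  also have "\<dots> = phi q * ((phim (q\<^sup>2))\<^sup>2 * psi2 (q\<^sup>2))"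
    by (simp add: phi_mult_appell_lerch[OF q] cube2_eq[OF square_lt_quarter[OF q]])
  also have "\<dots> = phim q * ((phi q)\<^sup>2 * psi2 (q\<^sup>2))"
    by (simp add: power2_eq_square flip: phi_mult_phim[OF q(1) q1, unfolded power2_eq_square])
  finally have "2 / phim q * (ell q * appell_lerch q 0) = (phi q)\<^sup>2 * psi2 (q\<^sup>2) / 2"
    using phim_nonzero[OF q] by (simp add: field_simps)
  then show ?thesis using G by (simp only:)
qed

end

section \<open>Comparing coefficients\<close>

lemma has_sum_product':
  fixes f :: "'a \<Rightarrow> real" and g :: "'b \<Rightarrow> real"
  assumes "(f has_sum a) A" "(g has_sum b) B"
  shows "((\<lambda>(x, y). f x * g y) has_sum (a * b)) (A \<times> B)"
  using has_sum_product[OF has_sum_imp_summable[OF assms(1)] has_sum_imp_summable[OF assms(2)]]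
  by (simp add: infsumI[OF assms(1)] infsumI[OF assms(2)])

lemma has_sum_nat_half:
  fixes f :: "int \<Rightarrow> real"
  assumes f: "f summable_on UNIV" and sym: "\<And>n. f (- 1 - n) = f n"
  shows "((\<lambda>n. f (int n)) has_sum (infsum f UNIV / 2)) UNIV"
proof -
  have f1: "f summable_on {0..}" and f2: "f summable_on {..<0}"
    by (rule summable_on_subset[OF f], simp)+
  have "infsum f UNIV = infsum f {0..} + infsum f {..<0}"
  proof -
    have "{0..} \<union> {..<0} = (UNIV :: int set)" "{0..} \<inter> {..<0} = ({} :: int set)" by auto
    then show ?thesis using infsum_Un_disjoint[OF f1 f2] by simp
  qed
  also have "infsum f {..<0} = infsum f {0..}"
    by (rule infsum_reindex_bij_witness[of _ "\<lambda>n. - 1 - n" "\<lambda>n. - 1 - n"]) (auto simp: sym)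
  finally have "infsum f {0..} = infsum f UNIV / 2" by simp
  then have "(f has_sum (infsum f UNIV / 2)) {0..}" using has_sum_infsum[OF f1] by (simp only:)
  moreover have "((\<lambda>n. f (int n)) has_sum (infsum f UNIV / 2)) UNIV \<longleftrightarrow> (f has_sum (infsum f UNIV / 2)) {0..}"
    by (rule has_sum_reindex_bij_witness[of _ nat int]) auto
  ultimately show ?thesis by simp
qed

lemma has_sum_geometric_two_sided:
  fixes y :: real
  assumes "0 < y" "y < 1"
  shows "((\<lambda>c::int. y powi \<bar>c\<bar>) has_sum ((1 + y) / (1 - y))) UNIV"
proof -
  have "((\<lambda>n. y ^ n) has_sum (1 / (1 - y))) (UNIV :: nat set)"
    using assms geometric_sums[of y] by (intro sums_nonneg_imp_has_sum) auto
  then have 1: "((\<lambda>c::int. y powi \<bar>c\<bar>) has_sum (1 / (1 - y))) {0..}"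
    by (subst has_sum_reindex_bij_witness[of _ int nat UNIV "\<lambda>n. y ^ n"]) (auto simp: power_int_nonneg_exp)
  have "((\<lambda>n. y ^ n) has_sum (y / (1 - y))) {1..}"
    using assms by (intro has_sum_geometric_from_1) auto
  then have 2: "((\<lambda>c::int. y powi \<bar>c\<bar>) has_sum (y / (1 - y))) {..<0}"
    by (subst has_sum_reindex_bij_witness[of _ "\<lambda>n. - int n" "\<lambda>c. nat (- c)" "{1..}" "\<lambda>n. y ^ n"])
       (auto simp: power_int_nonneg_exp)
  have "((\<lambda>c::int. y powi \<bar>c\<bar>) has_sum (1 / (1 - y) + y / (1 - y))) ({0..} \<union> {..<0})"
    by (rule has_sum_Un_disjoint[OF 1 2]) auto
  moreover have "{0..} \<union> {..<0} = (UNIV :: int set)" by auto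
  ultimately show ?thesis by (simp add: add_divide_distrib)
qed

section \<open>Identification of coefficients\<close>

lemma has_sum_by_exponent:
  fixes w :: "'a \<Rightarrow> real" and N :: "'a \<Rightarrow> int"
  assumes S: "((\<lambda>x. w x * q powi N x) has_sum S) A"
    and N: "\<And>x. x \<in> A \<Longrightarrow> N x \<ge> 0" and fin: "\<And>n. finite {x \<in> A. N x = int n}"
  shows "((\<lambda>n. (\<Sum>x | x \<in> A \<and> N x = int n. w x) * q ^ n) has_sum S) UNIV"
proof -
  let ?F = "\<lambda>n. {x \<in> A. N x = int n}"
  have "((\<lambda>(n, x). w x * q powi N x) has_sum S) (Sigma UNIV ?F) \<longleftrightarrow> ((\<lambda>x. w x * q powi N x) has_sum S) A"
    by (rule has_sum_reindex_bij_witness[of _ "\<lambda>x. (nat (N x), x)" snd]) (use N in auto)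
  then have "((\<lambda>(n, x). w x * q powi N x) has_sum S) (Sigma UNIV ?F)" using S by simp
  then show ?thesis
  proof (rule has_sum_Sigma')
    fix n
    show "((\<lambda>x. case (n, x) of (n, x) \<Rightarrow> w x * q powi N x) has_sum
        ((\<Sum>x | x \<in> A \<and> N x = int n. w x) * q ^ n)) (?F n)"
      by (rule has_sum_finiteI[OF fin]) (auto simp: sum_distrib_right intro!: sum.cong)
  qed
qed

text \<open>Once all lower coefficients vanish, dividing by \<open>q ^ n\<close> leaves a series
  with sum 0 whose limit at q = 0 is the n-th coefficient.\<close>

lemma power_series_zero:
  fixes e :: "nat \<Rightarrow> real"
  assumes r: "0 < r" "r \<le> 1"
    and e: "\<And>q. 0 < q \<Longrightarrow> q < r \<Longrightarrow> ((\<lambda>n. e n * q ^ n) has_sum 0) UNIV"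
  shows "e n = 0"
proof (induction n rule: less_induct)
  case (less n)
  have shift: "((\<lambda>k. e (n + k) * q powi int k) has_sum 0) UNIV" if q: "0 < q" "q < r" for q
  proof -
    have "((\<lambda>m. e m * q ^ m) has_sum 0) UNIV \<longleftrightarrow> ((\<lambda>m. e m * q ^ m) has_sum 0) {n..}"
      by (rule has_sum_cong_neutral) (use less in auto)
    then have "((\<lambda>m. e m * q ^ m) has_sum 0) {n..}" using e[OF q] by simp
    moreover have "((\<lambda>k. e (n + k) * q ^ (n + k)) has_sum 0) UNIV \<longleftrightarrow> ((\<lambda>m. e m * q ^ m) has_sum 0) {n..}"
      by (rule has_sum_reindex_bij_witness[of _ "\<lambda>m. m - n" "\<lambda>k. n + k"]) auto
    ultimately have "((\<lambda>k. 1 / q ^ n * (e (n + k) * q ^ (n + k))) has_sum (1 / q ^ n * 0)) UNIV"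
      by (intro has_sum_cmult_right) simp
    then show ?thesis using q by (simp add: power_add field_simps)
  qed
  have "((\<lambda>q. \<Sum>\<^sub>\<infinity>k. e (n + k) * q powi int k) \<longlongrightarrow> sum (\<lambda>k. e (n + k)) {0}) (at_right 0)"
    by (rule tendsto_theta_at_0[where r = "r / 2"])
       (use r has_sum_imp_summable[OF shift[of "r / 2"]] in auto)
  moreover have "eventually (\<lambda>q. (\<Sum>\<^sub>\<infinity>k. e (n + k) * q powi int k) = 0) (at_right 0)"
    unfolding eventually_at_right_field using r infsumI[OF shift] by blast
  ultimately have "((\<lambda>q::real. 0) \<longlongrightarrow> e n) (at_right 0)"
    using Lim_transform_eventually by fastforce
  then show ?case using tendsto_const_iff[of "at_right (0::real)" 0 "e n"] by simp
qed

lemma coefficients_eq: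
  fixes w :: "'a \<Rightarrow> real" and N :: "'a \<Rightarrow> int" and v :: "'b \<Rightarrow> real" and M :: "'b \<Rightarrow> int"
  assumes r: "0 < r" "r \<le> 1"
    and A: "\<And>q. 0 < q \<Longrightarrow> q < r \<Longrightarrow> ((\<lambda>x. w x * q powi N x) has_sum F q) A"
    and B: "\<And>q. 0 < q \<Longrightarrow> q < r \<Longrightarrow> ((\<lambda>x. v x * q powi M x) has_sum F q) B"
    and N: "\<And>x. x \<in> A \<Longrightarrow> N x \<ge> 0" and M: "\<And>x. x \<in> B \<Longrightarrow> M x \<ge> 0"
    and finA: "\<And>n. finite {x \<in> A. N x = int n}" and finB: "\<And>n. finite {x \<in> B. M x = int n}"
  shows "(\<Sum>x | x \<in> A \<and> N x = int n. w x) = (\<Sum>x | x \<in> B \<and> M x = int n. v x)"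
proof -
  define e where "e n = (\<Sum>x | x \<in> A \<and> N x = int n. w x) - (\<Sum>x | x \<in> B \<and> M x = int n. v x)" for n
  have "e n = 0"
  proof (rule power_series_zero[OF r])
    fix q assume q: "0 < q" "q < r"
    have "((\<lambda>n. (\<Sum>x | x \<in> A \<and> N x = int n. w x) * q ^ n + - ((\<Sum>x | x \<in> B \<and> M x = int n. v x) * q ^ n))
        has_sum (F q + - F q)) UNIV"
      by (intro has_sum_add has_sum_uminusI has_sum_by_exponent A B q N M finA finB)
    then show "((\<lambda>n. e n * q ^ n) has_sum 0) UNIV" by (simp add: e_def left_diff_distrib)
  qed
  then show ?thesis by (simp add: e_def)
qed

lemma has_sum_phi: "0 < q \<Longrightarrow> q < 1 \<Longrightarrow> ((\<lambda>n. q powi n\<^sup>2) has_sum phi q) UNIV"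
  and has_sum_phim: "0 < q \<Longrightarrow> q < 1 \<Longrightarrow> ((\<lambda>n. alt n * q powi n\<^sup>2) has_sum phim q) UNIV"
  and has_sum_psi2: "0 < q \<Longrightarrow> q < 1 \<Longrightarrow> ((\<lambda>n. q powi tri n) has_sum psi2 q) UNIV"
  by (simp_all add: phi_def phim_def psi2_def summable_theta)

lemma has_sum_psi2_nat:
  assumes "0 < q" "q < 1"
  shows "((\<lambda>n. q powi tri (int n)) has_sum (psi2 q / 2)) UNIV"
  unfolding psi2_def by (rule has_sum_nat_half) (use assms summable_theta tri_reflect in auto)

lemma has_sum_cube2_nat:
  assumes "0 < q" "q < 1/4"
  shows "((\<lambda>n. alt (int n) * real (2 * n + 1) * q powi tri (int n)) has_sum (cube2 q / 2)) UNIV"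
proof -
  have "((\<lambda>n. alt (int n) * real_of_int (2 * int n + 1) * q powi tri (int n)) has_sum (cube2 q / 2)) UNIV"
    unfolding cube2_def
    by (rule has_sum_nat_half) (use summable_theta_deriv[OF assms] tri_reflect in \<open>auto simp: alt_def\<close>)
  then show ?thesis by (simp add: add.commute)
qed

section \<open>Signed counts of representations\<close>

lemma nat_le_tri: "int n \<le> tri (int n)"
proof -
  have "0 \<le> int n * (int n - 1)" by (cases n) auto
  then show ?thesis using tri_double[of "int n"] by (simp add: algebra_simps)
qed

lemma finite_tri_fibre: "finite {m :: nat. c * tri (int m) = int n}" if "c > 0"
proof (rule finite_subset)
  show "{m :: nat. c * tri (int m) = int n} \<subseteq> {..n}"
  proof clarsimp
    fix m assume m: "c * tri (int m) = int n"
    have "1 * tri (int m) \<le> c * tri (int m)" using that tri_nonneg by (intro mult_right_mono) auto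
    then show "m \<le> n" using nat_le_tri[of m] m by linarith
  qed
qed simp

lemma finite_square_tri_tri: "finite {(x :: int, y :: nat, z :: nat). x\<^sup>2 + tri (int y) + tri (int z) = int n}"
proof (rule finite_subset)
  show "{(x :: int, y :: nat, z :: nat). x\<^sup>2 + tri (int y) + tri (int z) = int n}
      \<subseteq> {- int n..int n} \<times> {..n} \<times> {..n}"
  proof clarsimp
    fix x :: int and y z :: nat
    assume "x\<^sup>2 + tri (int y) + tri (int z) = int n"
    then show "- int n \<le> x \<and> x \<le> int n \<and> y \<le> n \<and> z \<le> n"
      using abs_le_power2[of x] nat_le_tri[of y] nat_le_tri[of z] by linarith
  qed
qed simp

lemma finite_square_square_tri: "finite {(x :: int, y :: int, z :: nat). x\<^sup>2 + y\<^sup>2 + tri (int z) = int n}"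
proof (rule finite_subset)
  show "{(x :: int, y :: int, z :: nat). x\<^sup>2 + y\<^sup>2 + tri (int z) = int n}
      \<subseteq> {- int n..int n} \<times> {- int n..int n} \<times> {..n}"
  proof clarsimp
    fix x y :: int and z :: nat
    assume "x\<^sup>2 + y\<^sup>2 + tri (int z) = int n"
    then show "- int n \<le> x \<and> x \<le> int n \<and> - int n \<le> y \<and> y \<le> int n \<and> z \<le> n"
      using abs_le_power2[of x] abs_le_power2[of y] nat_le_tri[of z] by linarith
  qed
qed simp

lemma sum_alt_card:
  assumes "finite S"
  shows "(\<Sum>p\<in>S. alt (f p)) = real (card {p \<in> S. even (f p)}) - real (card {p \<in> S. odd (f p)})"
proof -
  have "(\<Sum>p\<in>S. alt (f p)) = (\<Sum>p\<in>S. of_bool (even (f p))) - (\<Sum>p\<in>S. of_bool (odd (f p)))"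
    by (simp add: alt_def flip: sum_subtractf) (rule sum.cong, auto)
  then show ?thesis using assms by (simp add: Int_def)
qed

text \<open>Coefficients of phi(-q) psi(q)^2 = phi(-q) phi(q) psi(q^2) = phi(-q^2)^2 psi(q^2), which
  is the cube series at q^2. The right-hand sum is empty unless n is twice a triangular
  number.\<close>

lemma card_diff_square_tri_tri:
  "real (card {(x :: int, y :: nat, z :: nat). x\<^sup>2 + tri (int y) + tri (int z) = int n \<and> even x})
   - real (card {(x :: int, y :: nat, z :: nat). x\<^sup>2 + tri (int y) + tri (int z) = int n \<and> odd x})
   = (\<Sum>m | 2 * tri (int m) = int n. alt (int m) * real (2 * m + 1))"
proof -
  define N where "N = (\<lambda>(x :: int, y :: nat, z :: nat). x\<^sup>2 + tri (int y) + tri (int z))"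
  have fin: "finite {p. N p = int n}" for n
    using finite_square_tri_tri[of n] by (simp add: N_def case_prod_unfold)
  have "(\<Sum>p | p \<in> UNIV \<and> N p = int n. alt (fst p))
      = (\<Sum>m | m \<in> UNIV \<and> 2 * tri (int m) = int n. alt (int m) * real (2 * m + 1))"
  proof (rule coefficients_eq[where r = "1/4" and F = "\<lambda>q. cube2 (q\<^sup>2) / 2"])
    fix q :: real assume q: "0 < q" "q < 1/4"
    then have q1: "q < 1" by simp
    note h = has_sum_psi2_nat[OF q(1) q1]
    have "((\<lambda>(x, y, z). (alt x * q powi x\<^sup>2) * (q powi tri (int y) * q powi tri (int z)))
        has_sum (phim q * (psi2 q / 2 * (psi2 q / 2)))) UNIV"
      using has_sum_product'[OF has_sum_phim[OF q(1) q1] has_sum_product'[OF h h]]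
      by (simp add: case_prod_unfold)
    also have "phim q * (psi2 q / 2 * (psi2 q / 2)) = (phi q * phim q) * psi2 (q\<^sup>2) / 2"
      using psi2_square[OF q(1) q1] by (simp add: power2_eq_square)
    also have "\<dots> = cube2 (q\<^sup>2) / 2"
      by (simp add: phi_mult_phim[OF q(1) q1] cube2_eq[OF square_lt_quarter[OF q]])
    finally show "((\<lambda>p. alt (fst p) * q powi N p) has_sum cube2 (q\<^sup>2) / 2) UNIV"
      using q by (simp add: N_def case_prod_unfold power_int_add mult.assoc)
    show "((\<lambda>m. alt (int m) * real (2 * m + 1) * q powi (2 * tri (int m))) has_sum cube2 (q\<^sup>2) / 2) UNIV"
      using has_sum_cube2_nat[OF square_lt_quarter[OF q]] by (simp add: power_int_power)
  next
    show "finite {p \<in> UNIV. N p = int k}" "finite {m \<in> UNIV. 2 * tri (int m) = int k}" for k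
      using fin[of k] finite_tri_fibre[of 2 k] by simp_all
  qed (simp_all add: N_def tri_nonneg case_prod_unfold)
  then have "real (card {p \<in> {p. N p = int n}. even (fst p)}) - real (card {p \<in> {p. N p = int n}. odd (fst p)})
     = (\<Sum>m | 2 * tri (int m) = int n. alt (int m) * real (2 * m + 1))"
    using sum_alt_card[OF fin, of fst n] by simp
  moreover have "{p \<in> {p. N p = int n}. even (fst p)} =
      {(x, y, z). x\<^sup>2 + tri (int y) + tri (int z) = int n \<and> even x}"
    "{p \<in> {p. N p = int n}. odd (fst p)} =
      {(x, y, z). x\<^sup>2 + tri (int y) + tri (int z) = int n \<and> odd x}"
    by (auto simp: N_def)
  ultimately show ?thesis by simp
qed

text \<open>Coefficients of phi(-q)^2 psi(q), where a representation carries the sign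
  \<open>alt x * alt y = alt (x + y)\<close>.\<close>

lemma card_diff_square_square_tri:
  "real (card {(x :: int, y :: int, z :: nat). x\<^sup>2 + y\<^sup>2 + tri (int z) = int n \<and> even (x + y)})
   - real (card {(x :: int, y :: int, z :: nat). x\<^sup>2 + y\<^sup>2 + tri (int z) = int n \<and> odd (x + y)})
   = (\<Sum>m | tri (int m) = int n. alt (int m) * real (2 * m + 1))"
proof -
  define N where "N = (\<lambda>(x :: int, y :: int, z :: nat). x\<^sup>2 + y\<^sup>2 + tri (int z))"
  define s where "s = (\<lambda>(x :: int, y :: int, z :: nat). x + y)"
  have fin: "finite {p. N p = int n}" for n
    using finite_square_square_tri[of n] by (simp add: N_def case_prod_unfold)
  have "(\<Sum>p | p \<in> UNIV \<and> N p = int n. alt (s p))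
      = (\<Sum>m | m \<in> UNIV \<and> tri (int m) = int n. alt (int m) * real (2 * m + 1))"
  proof (rule coefficients_eq[where r = "1/4" and F = "\<lambda>q. cube2 q / 2"])
    fix q :: real assume q: "0 < q" "q < 1/4"
    then have q1: "q < 1" by simp
    note h = has_sum_phim[OF q(1) q1]
    have "((\<lambda>(x, y, z). (alt x * q powi x\<^sup>2) * ((alt y * q powi y\<^sup>2) * q powi tri (int z)))
        has_sum (phim q * (phim q * (psi2 q / 2)))) UNIV"
      using has_sum_product'[OF h has_sum_product'[OF h has_sum_psi2_nat[OF q(1) q1]]]
      by (simp add: case_prod_unfold)
    also have "phim q * (phim q * (psi2 q / 2)) = cube2 q / 2"
      by (simp add: cube2_eq[OF q] power2_eq_square)
    finally show "((\<lambda>p. alt (s p) * q powi N p) has_sum cube2 q / 2) UNIV"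
      using q by (simp add: N_def s_def case_prod_unfold power_int_add alt_add mult_ac)
    show "((\<lambda>m. alt (int m) * real (2 * m + 1) * q powi tri (int m)) has_sum cube2 q / 2) UNIV"
      using has_sum_cube2_nat[OF q] by simp
  next
    show "finite {p \<in> UNIV. N p = int k}" "finite {m \<in> UNIV. tri (int m) = int k}" for k
      using fin[of k] finite_tri_fibre[of 1 k] by simp_all
  qed (simp_all add: N_def tri_nonneg case_prod_unfold)
  then have "real (card {p \<in> {p. N p = int n}. even (s p)}) - real (card {p \<in> {p. N p = int n}. odd (s p)})
     = (\<Sum>m | tri (int m) = int n. alt (int m) * real (2 * m + 1))"
    using sum_alt_card[OF fin, of s n] by simp
  moreover have "{p \<in> {p. N p = int n}. even (s p)} =
      {(x, y, z). x\<^sup>2 + y\<^sup>2 + tri (int z) = int n \<and> even (x + y)}"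
    "{p \<in> {p. N p = int n}. odd (s p)} =
      {(x, y, z). x\<^sup>2 + y\<^sup>2 + tri (int z) = int n \<and> odd (x + y)}"
    by (auto simp: N_def s_def)
  ultimately show ?thesis by simp
qed

text \<open>With \<open>A = 2a+1\<close>, \<open>B = 2b\<close> and \<open>C = A + 4\<bar>c\<bar>\<close> one has \<open>A * C - B\<^sup>2 = 4 * form_exponent (a, b, c) + 1\<close>
  and \<open>\<bar>B\<bar> < A \<le> C\<close>, so \<open>forms\<close> lists reduced binary quadratic forms; the sign of \<open>c\<close> records which
  of the two outer coefficients is the larger one.\<close>

definition forms :: "(int \<times> int \<times> int) set" where
  "forms = Sigma {0..} (\<lambda>a. {-a..a} \<times> UNIV)"

definition form_exponent :: "int \<times> int \<times> int \<Rightarrow> int" where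
  "form_exponent = (\<lambda>(a, b, c). 2 * tri a - b\<^sup>2 + (2 * a + 1) * \<bar>c\<bar>)"

text \<open>From |b| <= a one gets a^2 + a - b^2 >= a. Together with |b| <= a the bound leaves
  finitely many forms for each exponent.\<close>

lemma form_exponent_ge:
  assumes "(a, b, c) \<in> forms"
  shows "a + \<bar>c\<bar> \<le> form_exponent (a, b, c)"
proof -
  have b: "\<bar>b\<bar> \<le> \<bar>a\<bar>" and a: "a \<ge> 0" using assms by (auto simp: forms_def)
  have "b\<^sup>2 \<le> a\<^sup>2" using b by (rule abs_le_square_iff[THEN iffD1])
  moreover have "1 * \<bar>c\<bar> \<le> (2 * a + 1) * \<bar>c\<bar>" using a by (intro mult_right_mono) auto
  ultimately show ?thesis unfolding form_exponent_def prod.case tri2 by linarith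
qed

lemma has_sum_forms:
  assumes q: "0 < q" "q < 1/4"
  shows "((\<lambda>p. q powi form_exponent p) has_sum ((phi q)\<^sup>2 * psi2 (q\<^sup>2) / 2)) forms"
proof -
  have inner: "((\<lambda>p. q powi form_exponent (a, p)) has_sum form_term q a) ({-a..a} \<times> UNIV)"
    if a: "a \<in> {0..}" for a
  proof -
    define y where "y = q powi (2 * a + 1)"
    have "y \<le> q powi 1" unfolding y_def using q a by (intro power_int_le_decreasing) auto
    then have y: "0 < y" "y < 1" using q by (auto simp: y_def)
    have 1: "((\<lambda>b. q powi (2 * tri a) * q powi (- b\<^sup>2)) has_sum (q powi (2 * tri a) * (\<Sum>b=-a..a. q powi (- b\<^sup>2)))) {-a..a}"
      by (intro has_sum_cmult_right has_sum_finite) simp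
    have "q powi (2 * tri a) * (\<Sum>b=-a..a. q powi (- b\<^sup>2)) * ((1 + y) / (1 - y)) = form_term q a"
      by (simp add: form_term_def y_def)
    moreover have "(\<lambda>(b, c). q powi (2 * tri a) * q powi (- b\<^sup>2) * y powi \<bar>c\<bar>) = (\<lambda>p. q powi form_exponent (a, p))"
    proof (rule ext, clarify)
      fix b c :: int
      have "form_exponent (a, b, c) = 2 * tri a + (- b\<^sup>2) + (2 * a + 1) * \<bar>c\<bar>" by (simp add: form_exponent_def)
      moreover have "q powi (m + n) = q powi m * q powi n" for m n
        using q by (intro power_int_add) simp
      ultimately show "q powi (2 * tri a) * q powi (- b\<^sup>2) * y powi \<bar>c\<bar> = q powi form_exponent (a, b, c)"
        unfolding y_def by (simp only: power_int_mult)
    qed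
    ultimately show ?thesis
      using has_sum_product'[OF 1 has_sum_geometric_two_sided[OF y]] by (simp only:)
  qed
  note outer = has_sum_form_term[OF q]
  have s: "(\<lambda>p. q powi form_exponent p) summable_on forms"
    unfolding forms_def
    by (rule summable_on_SigmaI[OF inner has_sum_imp_summable[OF outer]]) (use q in auto)
  show ?thesis
    unfolding forms_def by (rule has_sum_SigmaI[OF inner outer s[unfolded forms_def]])
qed

text \<open>Equivalently, 4n + 1 = (2x)^2 + (2y)^2 + (2z + 1)^2. The number of representations is
  twice a number of forms, and at least one form exists.\<close>

theorem sum_of_two_squares_and_double_tri:
  obtains x y z :: int where "int n = x\<^sup>2 + y\<^sup>2 + 2 * tri z"
proof -
  define N where "N = (\<lambda>(x :: int, y :: int, z :: int). x\<^sup>2 + y\<^sup>2 + 2 * tri z)"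
  have finN: "finite {p \<in> UNIV. N p = int n}" for n
  proof (rule finite_subset)
    have "- int n - 1 \<le> x \<and> x \<le> int n + 1 \<and> - int n - 1 \<le> y \<and> y \<le> int n + 1 \<and> - int n - 1 \<le> z \<and> z \<le> int n + 1"
      if "x\<^sup>2 + y\<^sup>2 + 2 * tri z = int n" for x y z
      using that abs_le_power2[of x] abs_le_power2[of y] tri_ge[of z] tri_nonneg[of z] by linarith
    then show "{p \<in> UNIV. N p = int n} \<subseteq> {- int n - 1..int n + 1} \<times> {- int n - 1..int n + 1} \<times> {- int n - 1..int n + 1}"
      by (auto simp: N_def)
  qed simp
  have finF: "finite {p \<in> forms. form_exponent p = int n}" for n
  proof (rule finite_subset)
    show "{p \<in> forms. form_exponent p = int n} \<subseteq> {0..int n} \<times> {- int n..int n} \<times> {- int n..int n}"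
    proof clarify
      fix a b c assume *: "(a, b, c) \<in> forms" "form_exponent (a, b, c) = int n"
      then show "a \<in> {0..int n} \<and> (b, c) \<in> {- int n..int n} \<times> {- int n..int n}"
        using form_exponent_ge[OF *(1)] by (auto simp: forms_def)
    qed
  qed simp
  \<comment> \<open>The weight 2 arises because z runs over all integers, so \<open>psi2\<close>
    replaces psi.\<close>
  have "(\<Sum>p | p \<in> UNIV \<and> N p = int n. 1 :: real) = (\<Sum>p | p \<in> forms \<and> form_exponent p = int n. 2)"
  proof (rule coefficients_eq[where r = "1/4" and F = "\<lambda>q. (phi q)\<^sup>2 * psi2 (q\<^sup>2)"])
    fix q :: real assume q: "0 < q" "q < 1/4"
    then have q1: "q < 1" by simp
    have q2: "q\<^sup>2 < 1" using square_lt_quarter[OF q] by simp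
    note h = has_sum_phi[OF q(1) q1]
    have "((\<lambda>(x, y, z). q powi x\<^sup>2 * (q powi y\<^sup>2 * q\<^sup>2 powi tri z)) has_sum (phi q * (phi q * psi2 (q\<^sup>2)))) UNIV"
      using has_sum_product'[OF h has_sum_product'[OF h has_sum_psi2[of "q\<^sup>2"]]] q q2
      by (simp add: case_prod_unfold)
    then show "((\<lambda>p. 1 * q powi N p) has_sum (phi q)\<^sup>2 * psi2 (q\<^sup>2)) UNIV"
      using q by (simp add: N_def case_prod_unfold power_int_add power_int_power power2_eq_square[of "phi q"] mult.assoc)
    show "((\<lambda>p. 2 * q powi form_exponent p) has_sum (phi q)\<^sup>2 * psi2 (q\<^sup>2)) forms"
      using has_sum_cmult_right[OF has_sum_forms[OF q], of 2] by simp
  next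
    show "form_exponent p \<ge> 0" if "p \<in> forms" for p
    proof -
      obtain a b c where p: "p = (a, b, c)" by (cases p)
      then have "a \<ge> 0" using that by (simp add: forms_def)
      then show ?thesis using form_exponent_ge[of a b c] that p by simp
    qed
    show "finite {p \<in> UNIV. N p = int k}" "finite {p \<in> forms. form_exponent p = int k}" for k
      by (rule finN finF)+
  qed (simp_all add: N_def tri_nonneg case_prod_unfold)
  also have "\<dots> > 0"
  proof -
    \<comment> \<open>For a = b = 0 the exponent is |c|: this is the form with outer coefficients 1
      and 4n + 1.\<close>
    have "(0, 0, int n) \<in> {p \<in> forms. form_exponent p = int n}"
      by (simp add: forms_def form_exponent_def tri_def)
    then have "card {p \<in> forms. form_exponent p = int n} > 0" using finF[of n] card_gt_0_iff by blast
    then show ?thesis by simp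
  qed
  finally have pos: "0 < (\<Sum>p | p \<in> UNIV \<and> N p = int n. 1 :: real)" .
  have "{p. p \<in> UNIV \<and> N p = int n} \<noteq> {}"
  proof
    assume "{p. p \<in> UNIV \<and> N p = int n} = {}"
    with pos show False by (simp only: sum.empty)
  qed
  then obtain p where p: "N p = int n" by blast
  obtain x y z where "p = (x, y, z)" by (cases p)
  then show ?thesis using p by (intro that[of x y z]) (simp add: N_def)
qed

section \<open>Sums of two squares\<close>

text \<open>The pair \<open>(0, 0)\<close> carries the constant term of the Lambert series.\<close>

definition hyperbola :: "(nat \<times> nat) set" where
  "hyperbola = insert (0, 0) ({1..} \<times> UNIV)"

definition hyperbola_weight :: "nat \<times> nat \<Rightarrow> real" where
  "hyperbola_weight = (\<lambda>(n, j). if n = 0 then 1 else 4 * alt (int j))"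

text \<open>By the symmetry of the kernel, 2 \<open>ell\<close> is 1 plus four times the kernel sum
  over n >= 1. With x = q^n, the kernel x/(1 + x^2) expands geometrically into the terms (-1)^j
  x^(2j+1).\<close>

lemma has_sum_hyperbola:
  assumes q: "0 < q" "q < 1/4"
  shows "((\<lambda>p. hyperbola_weight p * q powi (case p of (n, j) \<Rightarrow> int (n * (2 * j + 1)))) has_sum (phi q)\<^sup>2) hyperbola"
proof -
  have q1: "q < 1" using q by simp
  define f where "f = (\<lambda>p. hyperbola_weight p * q powi (case p of (n, j) \<Rightarrow> int (n * (2 * j + 1))))"
  define t where "t = (\<lambda>(n, j). 4 * alt (int j) * q ^ (n * (2 * j + 1)))"
  have inner: "((\<lambda>j. t (n, j)) has_sum (4 * kern q (int n))) UNIV" if n: "n \<in> {1..}" for n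
  proof -
    define x where "x = q ^ n"
    have "x \<le> q ^ 1" unfolding x_def using q n by (intro power_decreasing) auto
    then have x: "0 < x" "x < 1" using q by (auto simp: x_def)
    then have x2: "\<bar>- x\<^sup>2\<bar> < 1" by (simp add: power_less_one_iff)
    have "((\<lambda>j. (- x\<^sup>2) ^ j) has_sum (1 / (1 - (- x\<^sup>2)))) UNIV"
      using x2 by (intro norm_summable_imp_has_sum geometric_sums) (auto simp: norm_power intro!: summable_geometric)
    from has_sum_cmult_right[OF this, of "4 * x"]
    have "((\<lambda>j. 4 * x * (- x\<^sup>2) ^ j) has_sum (4 * (x / (1 + x\<^sup>2)))) UNIV" by simp
    moreover have "4 * x * (- x\<^sup>2) ^ j = t (n, j)" for j
    proof -
      have "(- x\<^sup>2) ^ j = alt (int j) * x ^ (2 * j)"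
        by (cases "even j") (simp_all add: alt_def power_mult)
      then show ?thesis by (simp add: t_def x_def power_mult power_add)
    qed
    moreover have "x / (1 + x\<^sup>2) = kern q (int n)"
    proof -
      have "x + inverse x = (1 + x\<^sup>2) / x" using x by (simp add: field_simps power2_eq_square)
      then show ?thesis by (simp add: kern_def power_int_minus flip: x_def)
    qed
    ultimately show ?thesis by simp
  qed
  have k: "((\<lambda>n. 4 * kern q (int n)) has_sum (2 * ell q - 1)) {1..}"
  proof -
    have s1: "kern q summable_on {0<..}" and s2: "kern q summable_on {..<0}" and s3: "kern q summable_on {0}"
      by (rule summable_on_subset[OF summable_kern(1)[OF q(1) q1]], simp)+
    have s4: "kern q summable_on {0<..} \<union> {..<0}" by (rule summable_on_union[OF s1 s2])
    have U: "(UNIV :: int set) = ({0<..} \<union> {..<0}) \<union> {0}" by auto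
    have "ell q = infsum (kern q) ({0<..} \<union> {..<0}) + infsum (kern q) {0}"
      unfolding ell_def U by (rule infsum_Un_disjoint[OF s4 s3]) auto
    also have "infsum (kern q) ({0<..} \<union> {..<0}) = infsum (kern q) {0<..} + infsum (kern q) {..<0}"
      by (rule infsum_Un_disjoint[OF s1 s2]) auto
    also have "infsum (kern q) {..<0} = infsum (kern q) {0<..}"
      by (rule infsum_reindex_bij_witness[of _ uminus uminus]) (auto simp: kern_minus)
    finally have "4 * infsum (kern q) {0<..} = 2 * ell q - 1" by (simp add: kern_def[of q 0])
    then have "((\<lambda>n. 4 * kern q n) has_sum (2 * ell q - 1)) {0<..}"
      using has_sum_cmult_right[OF has_sum_infsum[OF s1], of 4] by (simp only:)
    moreover have "((\<lambda>n. 4 * kern q (int n)) has_sum (2 * ell q - 1)) {1..} \<longleftrightarrow>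
        ((\<lambda>n. 4 * kern q n) has_sum (2 * ell q - 1)) {0<..}"
      by (rule has_sum_reindex_bij_witness[of _ nat int]) auto
    ultimately show ?thesis by simp
  qed
  have geo: "(\<lambda>n::nat. q ^ n) summable_on A" for A
    by (rule summable_on_subset[of _ UNIV], rule norm_summable_imp_summable_on)
       (use q in \<open>auto intro!: summable_geometric\<close>)
  have "t summable_on {1..} \<times> UNIV"
  proof (rule summable_on_product_bound[OF geo geo])
    fix n j :: nat assume "n \<in> {1..}"
    then have "1 * j \<le> n * j" by (intro mult_right_mono) auto
    then have "n + j \<le> n * (2 * j + 1)" by (simp add: algebra_simps)
    then have "q ^ (n * (2 * j + 1)) \<le> q ^ (n + j)" using q by (intro power_decreasing) auto
    then show "\<bar>t (n, j)\<bar> \<le> 4 * (q ^ n * q ^ j)"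
      using q by (simp add: t_def abs_mult abs_alt power_add)
  qed
  then have "(t has_sum (2 * ell q - 1)) ({1..} \<times> UNIV)"
    by (intro has_sum_SigmaI[where g = "\<lambda>n. 4 * kern q (int n)"] inner k)
  also have "?this \<longleftrightarrow> (f has_sum (2 * ell q - 1)) ({1..} \<times> UNIV)"
    by (rule has_sum_cong) (auto simp: t_def f_def hyperbola_weight_def simp del: of_nat_mult of_nat_add)
  finally have h: "(f has_sum (2 * ell q - 1)) ({1..} \<times> UNIV)" .
  have "(f has_sum (f (0, 0) + (2 * ell q - 1))) hyperbola"
    unfolding hyperbola_def by (rule has_sum_insert[OF _ h]) auto
  moreover have "f (0, 0) = 1" by (simp add: f_def hyperbola_weight_def)
  ultimately show ?thesis unfolding f_def by (simp add: phi_square_eq[OF q])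
qed

text \<open>Jacobi's two-square theorem: d is the cofactor of the odd divisor 2j + 1, and
  \<open>alt j\<close> is the nontrivial character modulo 4 at that divisor.\<close>

theorem card_two_squares:
  assumes "n > 0"
  shows "real (card {(x :: int, y :: int). x\<^sup>2 + y\<^sup>2 = int n})
    = 4 * (\<Sum>(d, j) | d * (2 * j + 1) = n. alt (int j))"
proof -
  define M where "M = (\<lambda>(d :: nat, j :: nat). int (d * (2 * j + 1)))"
  define N where "N = (\<lambda>(x :: int, y :: int). x\<^sup>2 + y\<^sup>2)"
  have finN: "finite {p \<in> UNIV. N p = int k}" for k
  proof (rule finite_subset)
    have "- int k \<le> x \<and> x \<le> int k \<and> - int k \<le> y \<and> y \<le> int k" if "x\<^sup>2 + y\<^sup>2 = int k" for x y
      using that abs_le_power2[of x] abs_le_power2[of y] by linarith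
    then show "{p \<in> UNIV. N p = int k} \<subseteq> {- int k..int k} \<times> {- int k..int k}"
      by (auto simp: N_def)
  qed simp
  have finM: "finite {p \<in> hyperbola. M p = int k}" for k
  proof (rule finite_subset)
    have "d \<le> k \<and> j \<le> k" if "d * (2 * j + 1) = k" "(d, j) \<in> hyperbola" for d j
    proof (cases "d = 0")
      case True
      then show ?thesis using that by (simp add: hyperbola_def)
    next
      case False
      then have "d * 1 \<le> d * (2 * j + 1)" "1 * (2 * j + 1) \<le> d * (2 * j + 1)"
        by (intro mult_left_mono mult_right_mono; simp)+
      then show ?thesis unfolding that(1) by simp
    qed
    then show "{p \<in> hyperbola. M p = int k} \<subseteq> {..k} \<times> {..k}"
      by (auto simp: M_def simp del: of_nat_mult of_nat_add)
  qed simp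
  have "(\<Sum>p | p \<in> UNIV \<and> N p = int n. 1 :: real) = (\<Sum>p | p \<in> hyperbola \<and> M p = int n. hyperbola_weight p)"
  proof (rule coefficients_eq[where r = "1/4" and F = "\<lambda>q. (phi q)\<^sup>2"])
    fix q :: real assume q: "0 < q" "q < 1/4"
    have h: "((\<lambda>n. q powi n\<^sup>2) has_sum phi q) UNIV" by (rule has_sum_phi) (use q in auto)
    have "((\<lambda>(x, y). q powi x\<^sup>2 * q powi y\<^sup>2) has_sum (phi q)\<^sup>2) UNIV"
      using has_sum_product'[OF h h] by (simp add: power2_eq_square[of "phi q"])
    then show "((\<lambda>p. 1 * q powi N p) has_sum (phi q)\<^sup>2) UNIV"
      using q by (simp add: N_def case_prod_unfold power_int_add)
    show "((\<lambda>p. hyperbola_weight p * q powi M p) has_sum (phi q)\<^sup>2) hyperbola"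
      unfolding M_def by (rule has_sum_hyperbola[OF q])
  next
    show "finite {p \<in> UNIV. N p = int k}" "finite {p \<in> hyperbola. M p = int k}" for k
      by (rule finN finM)+
  qed (simp_all add: N_def M_def case_prod_unfold)
  also have "{p. p \<in> hyperbola \<and> M p = int n} = {(d, j). d * (2 * j + 1) = n}"
    using assms by (auto simp: hyperbola_def M_def simp del: of_nat_mult of_nat_add)
  also have "(\<Sum>p \<in> \<dots>. hyperbola_weight p) = (\<Sum>(d, j) | d * (2 * j + 1) = n. 4 * alt (int j))"
    using assms by (intro sum.cong) (auto simp: hyperbola_weight_def)
  also have "\<dots> = 4 * (\<Sum>(d, j) | d * (2 * j + 1) = n. alt (int j))"
    by (simp add: sum_distrib_left case_prod_unfold)
  finally show ?thesis by (simp add: N_def case_prod_unfold)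
qed

section \<open>Numbers all of whose prime divisors are 1 modulo 4\<close>

lemma dvd_mod_4_if_primes:
  fixes d k :: nat
  assumes "\<And>p :: nat. prime p \<Longrightarrow> p dvd k \<Longrightarrow> p mod 4 = 1" and "d dvd k" "k > 0"
  shows "d mod 4 = 1"
  using assms(2)
proof (induction d rule: prime_divisors_induct)
  case zero
  then show ?case using assms(3) by simp
next
  case (unit d)
  then show ?case by simp
next
  case (factor p d)
  then have "p mod 4 = 1" "d mod 4 = 1" using assms(1) dvd_mult_left dvd_mult_right by blast+
  then show ?case by (simp add: mod_mult_eq[symmetric, of p d 4])
qed

text \<open>Every divisor is 1 modulo 4, so each term in Jacobi's formula is +1. There are at least
  two divisors, hence at least 8 representations, while at most 4 have a zero coordinate.\<close>

lemma two_nonzero_squares: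
  assumes "all_prime_divisors_1_mod_4 (2 * m + 1)" "m > 0"
  obtains x y :: int where "x \<noteq> 0" "y \<noteq> 0" "2 * m + 1 = x\<^sup>2 + y\<^sup>2"
proof -
  define n where "n = nat (2 * m + 1)"
  have n: "int n = 2 * m + 1" "n > 0" using assms by (auto simp: n_def)
  have pr: "p mod 4 = 1" if "prime p" "p dvd n" for p :: nat
  proof -
    have "[int p = 1] (mod 4)"
      using assms(1) that unfolding all_prime_divisors_1_mod_4_def n(1)[symmetric] by simp
    then have "[int p = int 1] (mod int 4)" by simp
    then show ?thesis unfolding cong_int_iff by (simp add: unique_euclidean_semiring_class.cong_def)
  qed
  define H where "H = {(d, j). d * (2 * j + 1) = n}"
  have one: "alt (int j) = 1" if "(d, j) \<in> H" for d j
  proof -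
    have "n = d * (2 * j + 1)" using that by (simp add: H_def)
    then have "2 * j + 1 dvd n" by (simp only: dvd_triv_right)
    then have "(2 * j + 1) mod 4 = 1" using dvd_mod_4_if_primes[OF pr _ n(2)] by blast
    then have "even j" by presburger
    then show ?thesis by (simp add: alt_def)
  qed
  have finH: "finite H"
  proof (rule finite_subset)
    show "H \<subseteq> {..n} \<times> {..n}"
    proof clarify
      fix d j assume dj: "(d, j) \<in> H"
      then have "d \<noteq> 0" using n by (auto simp: H_def)
      then have "d * 1 \<le> d * (2 * j + 1)" "1 * (2 * j + 1) \<le> d * (2 * j + 1)"
        by (intro mult_left_mono mult_right_mono; simp)+
      then show "d \<in> {..n} \<and> j \<in> {..n}" using dj unfolding H_def by auto
    qed
  qed simp
  define R where "R = {(x :: int, y :: int). x\<^sup>2 + y\<^sup>2 = int n}"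
  \<comment> \<open>These pairs encode the odd divisors 1 and n = 2m + 1, which are distinct because
    m > 0.\<close>
  have "{(n, 0), (1, nat m)} \<subseteq> H" using n assms(2) by (auto simp: H_def)
  then have "card {(n, 0), (1, nat m)} \<le> card H" by (rule card_mono[OF finH])
  then have "2 \<le> card H" using assms(2) by simp
  have "real (card R) = 4 * (\<Sum>(d, j) \<in> H. alt (int j))"
    using card_two_squares[OF n(2)] by (simp add: R_def H_def)
  also have "(\<Sum>(d, j) \<in> H. alt (int j)) = (\<Sum>p \<in> H. 1)" by (rule sum.cong) (use one in auto)
  finally have "card R = 4 * card H" by simp
  then have R: "card R \<ge> 8" using \<open>2 \<le> card H\<close> by simp
  have "\<exists>x y. (x, y) \<in> R \<and> x \<noteq> 0 \<and> y \<noteq> 0"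
  proof (rule ccontr)
    assume no: "\<nexists>x y. (x, y) \<in> R \<and> x \<noteq> 0 \<and> y \<noteq> 0"
    obtain a b where ab: "(a, b) \<in> R" using R by (cases "R = {}") auto
    \<comment> \<open>One of a and b is 0, so their sum is a square root of n.\<close>
    define s where "s = a + b"
    have "a = 0 \<or> b = 0" "a\<^sup>2 + b\<^sup>2 = int n" using ab no by (auto simp: R_def)
    then have s: "s\<^sup>2 = int n" by (auto simp: s_def)
    have "R \<subseteq> {(0, s), (0, - s), (s, 0), (- s, 0)}"
    proof
      fix p assume p: "p \<in> R"
      obtain x y where xy: "p = (x, y)" by (cases p)
      have "x\<^sup>2 + y\<^sup>2 = s\<^sup>2" "x = 0 \<or> y = 0" using p no xy s by (auto simp: R_def)
      then have "x = 0 \<and> (y = s \<or> y = - s) \<or> y = 0 \<and> (x = s \<or> x = - s)"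
        by (auto simp: power2_eq_iff)
      then show "p \<in> {(0, s), (0, - s), (s, 0), (- s, 0)}" using xy by auto
    qed
    then have "card R \<le> card {(0, s), (0, - s), (s, 0), (- s, 0)}" by (rule card_mono[rotated]) simp
    also have "\<dots> \<le> 4" by (simp add: card_insert_if)
    finally show False using R by simp
  qed
  then show ?thesis using that n(1) by (auto simp: R_def)
qed

section \<open>Squares and triangular numbers\<close>

lemma tri_nat_cases:
  obtains k :: nat where "tri m = tri (int k)"
proof (cases "m \<ge> 0")
  case True
  then show ?thesis using that[of "nat m"] by simp
next
  case False
  then show ?thesis using that[of "nat (- 1 - m)"] tri_reflect[of m] by simp
qed

lemma tri_nat_inj: "tri (int a) = tri (int b) \<Longrightarrow> a = b"
proof (induction a b rule: linorder_wlog)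
  case (le a b)
  have "(int b - int a) * (int a + int b + 1) = 0"
    using le(2) tri_double[of "int a"] tri_double[of "int b"] by (simp add: algebra_simps)
  then show ?case by simp
qed simp

lemma odd_square_tri: "(2 * z + 1)\<^sup>2 = 8 * tri z + 1"
  using tri2(1)[of z] by (simp add: power2_eq_square algebra_simps)

lemma cards_square_tri_tri_eq:
  assumes "\<not> triangular (of_nat n / 2)"
  shows "card {(x :: int, y :: nat, z :: nat). x\<^sup>2 + tri (int y) + tri (int z) = int n \<and> odd x}
    = card {(x :: int, y :: nat, z :: nat). x\<^sup>2 + tri (int y) + tri (int z) = int n \<and> even x}"
proof -
  have "2 * tri (int m) \<noteq> int n" for m
  proof
    assume "2 * tri (int m) = int n"
    then have "rat_of_int (2 * tri (int m)) = of_nat n" by simp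
    then have "of_nat n / 2 = (of_int (tri (int m)) :: rat)" by simp
    then show False using assms unfolding triangular_def by blast
  qed
  then show ?thesis using card_diff_square_tri_tri[of n] by simp
qed

lemma cards_square_square_tri_eq:
  assumes "\<And>m. int n \<noteq> tri m"
  shows "card {(x :: int, y :: int, z :: nat). x\<^sup>2 + y\<^sup>2 + tri (int z) = int n \<and> odd (x + y)}
    = card {(x :: int, y :: int, z :: nat). x\<^sup>2 + y\<^sup>2 + tri (int z) = int n \<and> even (x + y)}"
  using card_diff_square_square_tri[of n] assms[symmetric] by simp

text \<open>If n = 2 tri m, then x = 0 works. Otherwise y^2 + 2 tri z = tri(z + y) + tri(z - y)
  yields a representation; if its x is odd, the equality of the two counts supplies one with x
  even.\<close>

lemma even_square_tri_tri:
  obtains x y z :: int where "even x" "int n = x\<^sup>2 + tri y + tri z"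
proof (cases "triangular (of_nat n / 2)")
  case True
  then obtain m where "rat_of_nat n / 2 = of_int (tri m)" unfolding triangular_def by blast
  then have "rat_of_int (int n) = of_int (2 * tri m)" by simp
  then have "int n = 2 * tri m" by (simp only: of_int_eq_iff)
  then show ?thesis using that[of 0 m m] by simp
next
  case False
  obtain x y z where "int n = x\<^sup>2 + y\<^sup>2 + 2 * tri z" by (rule sum_of_two_squares_and_double_tri)
  then have n: "int n = x\<^sup>2 + tri (z + y) + tri (z - y)" by (simp add: tri_add_diff)
  obtain a b where ab: "tri (z + y) = tri (int a)" "tri (z - y) = tri (int b)"
    by (meson tri_nat_cases)
  let ?O = "{(x :: int, y :: nat, z :: nat). x\<^sup>2 + tri (int y) + tri (int z) = int n \<and> odd x}"
  let ?E = "{(x :: int, y :: nat, z :: nat). x\<^sup>2 + tri (int y) + tri (int z) = int n \<and> even x}"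
  have "finite ?O"
    by (rule finite_subset[OF _ finite_square_tri_tri[of n]]) auto
  then have "odd x \<Longrightarrow> card ?O > 0" using n ab by (auto simp: card_gt_0_iff)
  then have "odd x \<Longrightarrow> card ?E > 0" using cards_square_tri_tri_eq[OF False] by simp
  then have "odd x \<Longrightarrow> ?E \<noteq> {}" by (metis card.empty less_irrefl)
  moreover have "even x \<Longrightarrow> ?E \<noteq> {}" using n ab by auto
  ultimately have "?E \<noteq> {}" by blast
  then obtain x y z where "(x, y, z) \<in> ?E" by auto
  then show ?thesis using that[of x "int y" "int z"] by auto
qed

text \<open>In 2n = x^2 + y^2 + 2 tri z the numbers x and y have equal parity; halving their sum and
  difference represents n itself. Whichever parity class this falls in, the classes are equally
  large.\<close>

lemma card_even_square_square_tri_pos: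
  "card {(x :: int, y :: int, z :: nat). x\<^sup>2 + y\<^sup>2 + tri (int z) = int n \<and> even (x + y)} > 0"
  if "\<And>m. int n \<noteq> tri m"
proof -
  let ?O = "{(x :: int, y :: int, z :: nat). x\<^sup>2 + y\<^sup>2 + tri (int z) = int n \<and> odd (x + y)}"
  let ?E = "{(x :: int, y :: int, z :: nat). x\<^sup>2 + y\<^sup>2 + tri (int z) = int n \<and> even (x + y)}"
  obtain x y z where xyz: "int (2 * n) = x\<^sup>2 + y\<^sup>2 + 2 * tri z"
    by (rule sum_of_two_squares_and_double_tri)
  have "even (x\<^sup>2 + y\<^sup>2 + 2 * tri z)" unfolding xyz[symmetric] by simp
  then have "even (x + y)" by simp
  then have e: "even x = even y" by simp
  define u v where "u = (x + y) div 2" and "v = (x - y) div 2"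
  have "x = u + v" "y = u - v" using half_sum_diff_even[OF e] by (simp_all add: u_def v_def)
  moreover have "(u + v)\<^sup>2 + (u - v)\<^sup>2 = 2 * (u\<^sup>2 + v\<^sup>2)"
    by (simp add: power2_eq_square algebra_simps)
  ultimately have "2 * int n = 2 * (u\<^sup>2 + v\<^sup>2 + tri z)" using xyz by simp
  moreover obtain k where "tri z = tri (int k)" by (rule tri_nat_cases)
  ultimately have uv: "u\<^sup>2 + v\<^sup>2 + tri (int k) = int n" by simp
  have fin: "finite ?O" "finite ?E"
    by (rule finite_subset[OF _ finite_square_square_tri[of n]]; auto)+
  have "odd (u + v) \<Longrightarrow> card ?O > 0" "even (u + v) \<Longrightarrow> card ?E > 0"
    using uv fin by (auto simp: card_gt_0_iff)
  then show ?thesis using cards_square_square_tri_eq[OF that] by (cases "even (u + v)") auto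
qed

section \<open>Sums of an odd square, an even square and a triangular number\<close>

lemma odd_even_square_tri_if_odd_sum:
  assumes "odd (x + y)" "x\<^sup>2 + y\<^sup>2 + tri z = n"
  shows "\<exists>x y z. odd x \<and> even y \<and> n = x\<^sup>2 + y\<^sup>2 + tri z"
proof (cases "odd x")
  case True
  then show ?thesis using assms by (intro exI[of _ x] exI[of _ y] exI[of _ z]) auto
next
  case False
  then show ?thesis using assms by (intro exI[of _ y] exI[of _ x] exI[of _ z]) auto
qed

text \<open>The signed count has the single term -(2m + 1) < 0, so the class with x + y odd is not
  empty.\<close>

lemma tri_odd_index:
  assumes "odd m"
  obtains x y z :: int where "odd (x + y)" "x\<^sup>2 + y\<^sup>2 + tri z = tri (int m)"
proof -
  define n where "n = nat (tri (int m))"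
  have n: "int n = tri (int m)" by (simp add: n_def tri_nonneg)
  let ?O = "{(x :: int, y :: int, z :: nat). x\<^sup>2 + y\<^sup>2 + tri (int z) = int n \<and> odd (x + y)}"
  have "{k. tri (int k) = int n} = {m}" using tri_nat_inj n by auto
  then have "(\<Sum>k | tri (int k) = int n. alt (int k) * real (2 * k + 1)) < 0"
    using assms by (simp add: alt_def)
  then have "card ?O \<noteq> 0" using card_diff_square_square_tri[of n] by linarith
  then have "?O \<noteq> {}" by (metis card.empty)
  then obtain x y z where "(x, y, z) \<in> ?O" by auto
  then show ?thesis using that[of x y "int z"] n by auto
qed

text \<open>In terms of odd squares the hypothesis says (2l + 1)^2 = 8x^2 + 8y^2 + (2z + 1)^2; this
  is multiplied by k^2, and oddness of k keeps the last square odd.\<close>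

lemma tri_scale:
  assumes "odd k" and N: "2 * m + 1 = k * (2 * l + 1)" and l: "x\<^sup>2 + y\<^sup>2 + tri z = tri l"
  obtains w where "(k * x)\<^sup>2 + (k * y)\<^sup>2 + tri w = tri m"
proof -
  have "odd (k * (2 * z + 1))" using assms(1) by simp
  then obtain w where w: "k * (2 * z + 1) = 2 * w + 1" by (elim oddE)
  have "8 * tri m + 1 = (k * (2 * l + 1))\<^sup>2" using odd_square_tri[of m] by (simp add: N)
  also have "\<dots> = k\<^sup>2 * (8 * tri l + 1)" using odd_square_tri[of l] by (simp add: power_mult_distrib)
  also have "\<dots> = 8 * ((k * x)\<^sup>2 + (k * y)\<^sup>2) + k\<^sup>2 * (8 * tri z + 1)"
    by (simp add: power_mult_distrib algebra_simps flip: l)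
  also have "k\<^sup>2 * (8 * tri z + 1) = (k * (2 * z + 1))\<^sup>2"
    using odd_square_tri[of z] by (simp add: power_mult_distrib)
  also have "\<dots> = 8 * tri w + 1" using odd_square_tri[of w] by (simp add: w)
  finally show ?thesis using that[of w] by simp
qed

lemma odd_even_square_tri:
  assumes "n > 0" and no: "\<nexists>m. m > 0 \<and> int n = tri m \<and> all_prime_divisors_1_mod_4 (2 * m + 1)"
  shows "\<exists>x y z. odd x \<and> even y \<and> int n = x\<^sup>2 + y\<^sup>2 + tri z"
proof (cases "\<exists>m. int n = tri m")
  case False
  let ?O = "{(x :: int, y :: int, z :: nat). x\<^sup>2 + y\<^sup>2 + tri (int z) = int n \<and> odd (x + y)}"
  have "card ?O > 0"
    using False cards_square_square_tri_eq[of n] card_even_square_square_tri_pos[of n] by auto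
  then have "?O \<noteq> {}" by (metis card.empty less_irrefl)
  then obtain x y z where "(x, y, z) \<in> ?O" by auto
  then show ?thesis by (intro odd_even_square_tri_if_odd_sum[of x y "int z"]) auto
next
  case True
  then obtain m where m: "int n = tri (int m)" by (metis tri_nat_cases)
  then have "m > 0" using assms(1) by (cases m) (auto simp: tri_def)
  then have "\<not> all_prime_divisors_1_mod_4 (2 * int m + 1)" using no m by auto
  then obtain p where p: "prime p" "p dvd 2 * int m + 1" "\<not> [p = 1] (mod 4)"
    unfolding all_prime_divisors_1_mod_4_def by blast
  obtain k where k: "2 * int m + 1 = p * k" using p(2) by (elim dvdE)
  have "odd (p * k)" unfolding k[symmetric] by simp
  then have odd: "odd p" "odd k" by auto
  then have "p mod 4 = 3" using p(3) unfolding unique_euclidean_semiring_class.cong_def by presburger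
  \<comment> \<open>The prime p = 2l + 1 is 3 modulo 4, so l is odd and \<open>tri_odd_index\<close>
    applies to it; the odd cofactor k then scales the result to m and preserves the parity of x +
    y.\<close>
  define l where "l = nat (p div 2)"
  have "p > 0" using p(1) prime_gt_0_int by blast
  then have l: "p = 2 * int l + 1" using odd(1) by (simp add: l_def)
  then have "odd l" using \<open>p mod 4 = 3\<close> by presburger
  then obtain x y z where xyz: "odd (x + y)" "x\<^sup>2 + y\<^sup>2 + tri z = tri (int l)"
    by (rule tri_odd_index)
  obtain w where w: "(k * x)\<^sup>2 + (k * y)\<^sup>2 + tri w = tri (int m)"
    by (rule tri_scale[OF odd(2) _ xyz(2)]) (use k l in \<open>simp add: mult.commute\<close>)
  have "odd (k * x + k * y)" using xyz(1) odd(2) by (simp flip: distrib_left)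
  then show ?thesis using w m by (intro odd_even_square_tri_if_odd_sum) auto
qed

section \<open>Triangular numbers with two equal squares\<close>

lemma cong_2_iff: "\<not> [x = y] (mod 2) \<longleftrightarrow> odd (x + y)" "[x = y] (mod 2) \<longleftrightarrow> even (x + y)" for x y :: int
proof -
  show "[x = y] (mod 2) \<longleftrightarrow> even (x + y)" unfolding unique_euclidean_semiring_class.cong_def by presburger
  then show "\<not> [x = y] (mod 2) \<longleftrightarrow> odd (x + y)" by simp
qed

text \<open>Squaring gives (2m + 1)^2 = (a^2 - 4c^2)^2 + 16 (ac)^2, so x = |ac| works. With a = 2b +
  1 one has m/2 = 2 tri b + c^2, which has the parity of c and hence of ac.\<close>

lemma tri_double_square:
  fixes a c m :: int
  assumes "odd a" "c \<noteq> 0" and N: "2 * m + 1 = a\<^sup>2 + (2 * c)\<^sup>2"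
  shows "\<exists>x z. x > 0 \<and> [x = m div 2] (mod 2) \<and> tri m = x\<^sup>2 + x\<^sup>2 + tri z"
proof -
  obtain b where b: "a = 2 * b + 1" using assms(1) by (elim oddE)
  have "a\<^sup>2 = 8 * tri b + 1" unfolding b by (rule odd_square_tri)
  then have m: "m = 2 * (2 * tri b + c\<^sup>2)" using N by (simp add: power_mult_distrib)
  have "odd (a\<^sup>2 - (2 * c)\<^sup>2)" using assms(1) by simp
  then obtain z where z: "a\<^sup>2 - (2 * c)\<^sup>2 = 2 * z + 1" by (elim oddE)
  have "8 * tri m + 1 = (a\<^sup>2 + (2 * c)\<^sup>2)\<^sup>2" using odd_square_tri[of m] by (simp add: N)
  also have "\<dots> = (a\<^sup>2 - (2 * c)\<^sup>2)\<^sup>2 + 16 * (a * c)\<^sup>2" by (simp add: power2_eq_square algebra_simps)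
  also have "\<dots> = 8 * tri z + 1 + 16 * (a * c)\<^sup>2" unfolding z odd_square_tri ..
  finally have "tri m = \<bar>a * c\<bar>\<^sup>2 + \<bar>a * c\<bar>\<^sup>2 + tri z" by simp
  moreover have "\<bar>a * c\<bar> > 0" using assms by auto
  moreover have "[\<bar>a * c\<bar> = m div 2] (mod 2)"
  proof -
    have "even \<bar>a * c\<bar> = even (m div 2)" using assms(1) by (simp add: m)
    then show ?thesis by (simp add: cong_2_iff)
  qed
  ultimately show ?thesis by blast
qed

lemma tri_double_square_if_primes:
  assumes "m > 0" "all_prime_divisors_1_mod_4 (2 * m + 1)"
  shows "\<exists>x z. x > 0 \<and> [x = m div 2] (mod 2) \<and> tri m = x\<^sup>2 + x\<^sup>2 + tri z"
proof -
  obtain x y where xy: "x \<noteq> 0" "y \<noteq> 0" "2 * m + 1 = x\<^sup>2 + y\<^sup>2"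
    using two_nonzero_squares[OF assms(2,1)] .
  have "odd (x\<^sup>2 + y\<^sup>2)" unfolding xy(3)[symmetric] by simp
  then have "odd (x + y)" by simp
  show ?thesis
  proof (cases "odd x")
    case True
    then have "even y" using \<open>odd (x + y)\<close> by simp
    then obtain c where "y = 2 * c" by (elim evenE)
    then show ?thesis using tri_double_square[OF True, of c m] xy by simp
  next
    case False
    then have "odd y" using \<open>odd (x + y)\<close> by simp
    moreover obtain c where "x = 2 * c" using False by auto
    ultimately show ?thesis using tri_double_square[of y c m] xy by (simp add: add.commute)
  qed
qed

theorem theorem1:
  shows
    "(\<forall>n::nat. \<exists>x y z :: int. even x \<and> int n = x\<^sup>2 + tri y + tri z) \<and>
     (\<forall>n::nat. \<not> triangular (of_nat n / 2) \<longrightarrow>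
        card {(x :: int, y :: nat, z :: nat). x\<^sup>2 + tri (int y) + tri (int z) = int n \<and> \<not> 2 dvd x} =
        card {(x :: int, y :: nat, z :: nat). x\<^sup>2 + tri (int y) + tri (int z) = int n \<and> 2 dvd x}) \<and>

     (\<forall>n::nat. \<not> triangular (of_nat n) \<longrightarrow>
        card {(x :: int, y :: int, z :: nat). x\<^sup>2 + y\<^sup>2 + tri (int z) = int n \<and> \<not> [x = y] (mod 2)} =
        card {(x :: int, y :: int, z :: nat). x\<^sup>2 + y\<^sup>2 + tri (int z) = int n \<and> [x = y] (mod 2)} \<and>
        card {(x :: int, y :: int, z :: nat). x\<^sup>2 + y\<^sup>2 + tri (int z) = int n \<and> [x = y] (mod 2)} > 0) \<and>

     (\<forall>n::nat. n > 0 \<longrightarrow>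
        \<not> (\<exists>m :: int. m > 0 \<and> int n = tri m \<and> all_prime_divisors_1_mod_4 (2 * m + 1)) \<longrightarrow>
        (\<exists>x y z :: int. odd x \<and> even y \<and> int n = x\<^sup>2 + y\<^sup>2 + tri z)) \<and>
     (\<forall>m :: int. m > 0 \<longrightarrow> all_prime_divisors_1_mod_4 (2 * m + 1) \<longrightarrow>
        (\<exists>x z :: int. x > 0 \<and> [x = m div 2] (mod 2) \<and> tri m = x\<^sup>2 + x\<^sup>2 + tri z))"
proof (intro conjI allI impI)
  fix n :: nat
  show "\<exists>x y z :: int. even x \<and> int n = x\<^sup>2 + tri y + tri z"
    using even_square_tri_tri[of n] by metis
next
  fix n :: nat assume "\<not> triangular (of_nat n / 2)"
  then show "card {(x :: int, y :: nat, z :: nat). x\<^sup>2 + tri (int y) + tri (int z) = int n \<and> \<not> 2 dvd x} =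
      card {(x :: int, y :: nat, z :: nat). x\<^sup>2 + tri (int y) + tri (int z) = int n \<and> 2 dvd x}"
    by (rule cards_square_tri_tri_eq)
next
  fix n :: nat assume "\<not> triangular (of_nat n)"
  then have n: "int n \<noteq> tri m" for m
    unfolding triangular_def by (metis of_int_of_nat_eq)
  show "card {(x :: int, y :: int, z :: nat). x\<^sup>2 + y\<^sup>2 + tri (int z) = int n \<and> \<not> [x = y] (mod 2)} =
      card {(x :: int, y :: int, z :: nat). x\<^sup>2 + y\<^sup>2 + tri (int z) = int n \<and> [x = y] (mod 2)}"
    unfolding cong_2_iff by (rule cards_square_square_tri_eq[OF n])
  show "card {(x :: int, y :: int, z :: nat). x\<^sup>2 + y\<^sup>2 + tri (int z) = int n \<and> [x = y] (mod 2)} > 0"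
    unfolding cong_2_iff by (rule card_even_square_square_tri_pos[OF n])
qed (use odd_even_square_tri tri_double_square_if_primes in blast)+

end
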